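(* Let $(M,g)$ be a Riemannian manifold of dimension $n\ge 4$, and let $h_4=\frac{1}{4!}c^4(R^2)$ be its second H. Weyl curvature invariant. (1) If $(M,g)$ is an Einstein manifold, then $h_4\ge 0$ on $M$, and $h_4\equiv 0$ if and only if $(M,g)$ is flat. (2) If $(M,g)$ is conformally flat with zero scalar curvature, then $h_4\le 0$ on $M$, and $h_4\equiv 0$ if and only if $(M,g)$ is flat.
   Context: For each tangent space $V=T_mM$ let $D^{p,q}=\Lambda^pV^*\otimes\Lambda^qV^*$ (double forms), identified with bilinear forms $\Lambda^pV\times\Lambda^qV\to\mathbb R$. The product is $(\theta_1\otimes\theta_2)\cdot(\theta_3\otimes\theta_4)=(\theta_1\wedge\theta_3)\otimes(\theta_2\wedge\theta_4)$, with the wedge product normalized so that wedges of distinct elements of a dual basis evaluate to $1$ on the corresponding wedges of basis vectors. The contraction $c:D^{p,q}\to D^{p-1,q-1}$ is $c\omega(x_1\wedge\dots\wedge x_{p-1},y_1\wedge\dots\wedge y_{q-1})=\sum_{j=1}^n\omega(e_j\wedge x_1\wedge\dots\wedge x_{p-1},e_j\wedge y_1\wedge\dots\wedge y_{q-1})$ for any orthonormal basis $(e_j)$ of $V$ (and $c\omega=0$ if $p=0$ or $q=0$). The Riemann curvature tensor $R$ is viewed as an element of $D^{2,2}$, with sign such that $R(x\wedge y,x\wedge y)$ is the sectional curvature of the plane spanned by orthonormal $x,y$; so $cR$ is the Ricci tensor and $c^2R$ the scalar curvature. $R^2=R\cdot R\in D^{4,4}$. With the natural inner product on $D^{p,q}$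 (for which the elements $e_{i_1}\wedge\dots\wedge e_{i_p}\otimes e_{j_1}\wedge\dots\wedge e_{j_q}$ with increasing indices are orthonormal) one has equivalently $h_4=|R|^2-|cR|^2+\frac14|c^2R|^2$. Einstein means that the Ricci tensor is a constant multiple of $g$; conformally flat means locally conformal to a flat metric (equivalently, since $n\ge4$, zero Weyl tensor). *)

theory Defs
  imports "HOL-Analysis.Analysis"
begin

section \<open>Double forms on a finite-dimensional inner product space\<close>

text \<open>
  A form of degree \<open>p\<close> on \<open>V\<close>, that is, an element of the \<open>p\<close>-th exterior power of the dual of
  \<open>V\<close>, is represented by the alternating \<open>p\<close>-linear function of its list of arguments.
  An element of \<open>D\<^sup>p\<^sup>,\<^sup>q\<close> is its bidegree together with a function of a list of \<open>p\<close> and a list of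
  \<open>q\<close> vectors; its values on lists of other lengths have no meaning.
\<close>

datatype 'v double_form =
  DForm (ldeg: nat) (rdeg: nat) (dval: "'v list \<Rightarrow> 'v list \<Rightarrow> real")

text \<open>
  Wedge product of forms of degrees \<open>p\<close> and \<open>r\<close>, normalised so that wedges of distinct elements of
  a dual basis take the value 1 on the corresponding lists of basis vectors.
\<close>

definition wedge ::
  "nat \<Rightarrow> nat \<Rightarrow> ('v list \<Rightarrow> real) \<Rightarrow> ('v list \<Rightarrow> real) \<Rightarrow> 'v list \<Rightarrow> real"
  where "wedge p r \<alpha> \<beta> xs =
    (\<Sum>\<sigma> | \<sigma> permutes {..<p + r}. of_int (sign \<sigma>) *
        \<alpha> (map (\<lambda>i. xs ! \<sigma> i) [0..<p]) * \<beta> (map (\<lambda>i. xs ! \<sigma> i) [p..<p + r]))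
      / (fact p * fact r)"

definition tensor ::
  "nat \<Rightarrow> nat \<Rightarrow> ('v list \<Rightarrow> real) \<Rightarrow> ('v list \<Rightarrow> real) \<Rightarrow> 'v double_form"
  where "tensor p q \<alpha> \<beta> = DForm p q (\<lambda>xs ys. \<alpha> xs * \<beta> ys)"

text \<open>
  The product of double forms is the bilinear extension of
  \<open>(\<theta>\<^sub>1 \<otimes> \<theta>\<^sub>2) \<cdot> (\<theta>\<^sub>3 \<otimes> \<theta>\<^sub>4) = (\<theta>\<^sub>1 \<and> \<theta>\<^sub>3) \<otimes> (\<theta>\<^sub>2 \<and> \<theta>\<^sub>4)\<close>: the explicit formula below antisymmetrises
  separately in the two groups of arguments; \<open>double_form_mult_tensor\<close> is the rule for
  decomposable factors.
\<close>

fun double_form_mult :: "'v double_form \<Rightarrow> 'v double_form \<Rightarrow> 'v double_form"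
  where "double_form_mult (DForm p q \<omega>) (DForm r s \<eta>) =
    DForm (p + r) (q + s) (\<lambda>xs ys.
      (\<Sum>\<sigma> | \<sigma> permutes {..<p + r}. \<Sum>\<tau> | \<tau> permutes {..<q + s}.
          of_int (sign \<sigma>) * of_int (sign \<tau>) *
          \<omega> (map (\<lambda>i. xs ! \<sigma> i) [0..<p]) (map (\<lambda>i. ys ! \<tau> i) [0..<q]) *
          \<eta> (map (\<lambda>i. xs ! \<sigma> i) [p..<p + r]) (map (\<lambda>i. ys ! \<tau> i) [q..<q + s]))
        / (fact p * fact q * fact r * fact s))"

lemma double_form_mult_tensor:
  "double_form_mult (tensor p q \<alpha> \<beta>) (tensor r s \<gamma> \<delta>) =
     tensor (p + r) (q + s) (wedge p r \<alpha> \<gamma>) (wedge q s \<beta> \<delta>)"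
  by (simp add: tensor_def wedge_def sum_product mult_ac)

text \<open>
  An inner product on \<open>real ^ 'n\<close> is given by its Gram matrix \<open>G\<close>.
\<close>

definition ip :: "real ^ 'n ^ 'n \<Rightarrow> real ^ 'n \<Rightarrow> real ^ 'n \<Rightarrow> real"
  where "ip G x y = x \<bullet> (G *v y)"

definition orthonormal_frame :: "real ^ 'n ^ 'n \<Rightarrow> ('n \<Rightarrow> real ^ 'n) \<Rightarrow> bool"
  where "orthonormal_frame G e \<longleftrightarrow> (\<forall>i j. ip G (e i) (e j) = (if i = j then 1 else 0))"

text \<open>
  The contraction does not depend on the orthonormal basis, so an arbitrary one is chosen.
\<close>

fun contract :: "real ^ 'n ^ 'n \<Rightarrow> (real ^ 'n) double_form \<Rightarrow> (real ^ 'n) double_form"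
  where "contract G (DForm p q \<omega>) =
    DForm (p - 1) (q - 1)
      (if p = 0 \<or> q = 0 then (\<lambda>xs ys. 0)
       else (let e = (SOME e. orthonormal_frame G e)
             in (\<lambda>xs ys. \<Sum>j\<in>UNIV. \<omega> (e j # xs) (e j # ys))))"


section \<open>Smooth functions on open subsets of coordinate space\<close>

definition pderivative :: "'n \<Rightarrow> (real ^ 'n \<Rightarrow> real) \<Rightarrow> real ^ 'n \<Rightarrow> real"
  where "pderivative i f x = frechet_derivative f (at x) (axis i 1)"

fun Ck_on :: "nat \<Rightarrow> (real ^ 'n) set \<Rightarrow> (real ^ 'n \<Rightarrow> real) \<Rightarrow> bool"
  where
    "Ck_on 0 S f \<longleftrightarrow> continuous_on S f"
  | "Ck_on (Suc k) S f \<longleftrightarrow>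
       (\<forall>x\<in>S. f differentiable (at x)) \<and> (\<forall>i. Ck_on k S (pderivative i f))"

definition smooth_on :: "(real ^ 'n) set \<Rightarrow> (real ^ 'n \<Rightarrow> real) \<Rightarrow> bool"
  where "smooth_on S f \<longleftrightarrow> (\<forall>k. Ck_on k S f)"


section \<open>Riemannian manifolds\<close>

text \<open>A chart consists of its domain and its coordinate map.\<close>

type_synonym ('m, 'n) chart = "'m set \<times> ('m \<Rightarrow> real ^ 'n)"

abbreviation cdom :: "('m, 'n) chart \<Rightarrow> 'm set" where "cdom \<equiv> fst"
abbreviation cmap :: "('m, 'n) chart \<Rightarrow> 'm \<Rightarrow> real ^ 'n" where "cmap \<equiv> snd"
abbreviation cinv :: "('m, 'n) chart \<Rightarrow> real ^ 'n \<Rightarrow> 'm" where "cinv c \<equiv> inv_into (cdom c) (cmap c)"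

definition chart_on :: "'m topology \<Rightarrow> ('m, 'n::finite) chart \<Rightarrow> bool"
  where "chart_on X c \<longleftrightarrow>
    openin X (cdom c) \<and> open (cmap c ` cdom c) \<and>
    homeomorphic_map (subtopology X (cdom c)) (top_of_set (cmap c ` cdom c)) (cmap c)"

definition transition :: "('m, 'n) chart \<Rightarrow> ('m, 'n) chart \<Rightarrow> real ^ 'n \<Rightarrow> real ^ 'n"
  where "transition c d = cmap d \<circ> cinv c"

definition smooth_manifold :: "'m topology \<Rightarrow> ('m, 'n::finite) chart set \<Rightarrow> bool"
  where "smooth_manifold X A \<longleftrightarrow>
    Hausdorff_space X \<and> second_countable X \<and>
    (\<forall>c\<in>A. chart_on X c) \<and> (\<Union>c\<in>A. cdom c) = topspace X \<and>
    (\<forall>c\<in>A. \<forall>d\<in>A. \<forall>i.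
       smooth_on (cmap c ` (cdom c \<inter> cdom d)) (\<lambda>x. transition c d x $ i))"

text \<open>
  A metric is given by its component matrices: \<open>g c x\<close> is the matrix of \<open>g\<close> in the coordinates of
  the chart \<open>c\<close>, at the point of \<open>cdom c\<close> with coordinates \<open>x\<close>.  The last condition is the
  transformation law of covariant 2-tensors.
\<close>

type_synonym ('m, 'n) metric = "('m, 'n) chart \<Rightarrow> real ^ 'n \<Rightarrow> real ^ 'n ^ 'n"

definition riemannian_manifold ::
  "'m topology \<Rightarrow> ('m, 'n::finite) chart set \<Rightarrow> ('m, 'n) metric \<Rightarrow> bool"
  where "riemannian_manifold X A g \<longleftrightarrow>
    smooth_manifold X A \<and>
    (\<forall>c\<in>A. \<forall>i j. smooth_on (cmap c ` cdom c) (\<lambda>x. g c x $ i $ j)) \<and>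
    (\<forall>c\<in>A. \<forall>x\<in>cmap c ` cdom c.
       transpose (g c x) = g c x \<and> (\<forall>v. v \<noteq> 0 \<longrightarrow> 0 < ip (g c x) v v)) \<and>
    (\<forall>c\<in>A. \<forall>d\<in>A. \<forall>m\<in>cdom c \<inter> cdom d.
       let J = matrix (frechet_derivative (transition c d) (at (cmap c m)))
       in g c (cmap c m) = transpose J ** g d (cmap d m) ** J)"


section \<open>Curvature in coordinates\<close>

text \<open>\<open>christoffel G k i j x\<close> is \<open>\<Gamma>\<^sup>k\<^sub>i\<^sub>j\<close> at \<open>x\<close> for the coordinate metric \<open>G\<close>.\<close>

definition christoffel ::
  "(real ^ 'n \<Rightarrow> real ^ 'n ^ 'n) \<Rightarrow> 'n \<Rightarrow> 'n \<Rightarrow> 'n \<Rightarrow> real ^ 'n::finite \<Rightarrow> real"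
  where "christoffel G k i j x = 1 / 2 *
    (\<Sum>l\<in>UNIV. matrix_inv (G x) $ k $ l *
      (pderivative i (\<lambda>y. G y $ j $ l) x + pderivative j (\<lambda>y. G y $ i $ l) x
        - pderivative l (\<lambda>y. G y $ i $ j) x))"

text \<open>
  \<open>riemann_op G a i j k\<close> is the \<open>\<partial>\<^sub>a\<close>-component of
  \<open>R(\<partial>\<^sub>i, \<partial>\<^sub>j)\<partial>\<^sub>k = \<nabla>\<^sub>i\<nabla>\<^sub>j\<partial>\<^sub>k - \<nabla>\<^sub>j\<nabla>\<^sub>i\<partial>\<^sub>k\<close> for the Levi-Civita connection.
\<close>

definition riemann_op ::
  "(real ^ 'n \<Rightarrow> real ^ 'n ^ 'n) \<Rightarrow> 'n \<Rightarrow> 'n \<Rightarrow> 'n \<Rightarrow> 'n \<Rightarrow> real ^ 'n::finite \<Rightarrow> real"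
  where "riemann_op G a i j k x =
    pderivative i (christoffel G a j k) x - pderivative j (christoffel G a i k) x
    + (\<Sum>b\<in>UNIV. christoffel G a i b x * christoffel G b j k x
                 - christoffel G a j b x * christoffel G b i k x)"

text \<open>
  The curvature tensor as an element of \<open>D\<^sup>2\<^sup>,\<^sup>2\<close>, with the sign
  \<open>R(x \<and> y, z \<and> w) = g(R(x, y)w, z)\<close>; hence \<open>R(x \<and> y, x \<and> y) = g(R(x, y)y, x)\<close> is the sectional
  curvature of the plane spanned by orthonormal vectors \<open>x\<close>, \<open>y\<close>.
\<close>

definition coord_curvature ::
  "(real ^ 'n \<Rightarrow> real ^ 'n ^ 'n) \<Rightarrow> real ^ 'n::finite \<Rightarrow> (real ^ 'n) double_form"
  where "coord_curvature G p = DForm 2 2 (\<lambda>xs ys.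
    \<Sum>i\<in>UNIV. \<Sum>j\<in>UNIV. \<Sum>k\<in>UNIV. \<Sum>l\<in>UNIV.
      (xs ! 0) $ i * (xs ! 1) $ j * (ys ! 0) $ k * (ys ! 1) $ l *
      (\<Sum>a\<in>UNIV. G p $ k $ a * riemann_op G a i j l p))"


section \<open>Tensors on a Riemannian manifold\<close>

text \<open>
  The tangent space at a point \<open>m\<close> is identified with \<open>real ^ 'n\<close> by means of a preferred chart
  around \<open>m\<close>.  Another choice of chart changes the double forms below by the linear isomorphism
  given by the Jacobian matrix, and leaves scalars such as \<open>h4\<close> unchanged.
\<close>

definition chart_at :: "('m, 'n) chart set \<Rightarrow> 'm \<Rightarrow> ('m, 'n) chart"
  where "chart_at A m = (SOME c. c \<in> A \<and> m \<in> cdom c)"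

definition metric_at :: "('m, 'n::finite) chart set \<Rightarrow> ('m, 'n) metric \<Rightarrow> 'm \<Rightarrow> real ^ 'n ^ 'n"
  where "metric_at A g m = g (chart_at A m) (cmap (chart_at A m) m)"

definition curvature_at ::
  "('m, 'n::finite) chart set \<Rightarrow> ('m, 'n) metric \<Rightarrow> 'm \<Rightarrow> (real ^ 'n) double_form"
  where "curvature_at A g m = coord_curvature (g (chart_at A m)) (cmap (chart_at A m) m)"

definition ricci_at ::
  "('m, 'n::finite) chart set \<Rightarrow> ('m, 'n) metric \<Rightarrow> 'm \<Rightarrow> (real ^ 'n) double_form"
  where "ricci_at A g m = contract (metric_at A g m) (curvature_at A g m)"

definition scalar_curvature ::
  "('m, 'n::finite) chart set \<Rightarrow> ('m, 'n) metric \<Rightarrow> 'm \<Rightarrow> real"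
  where "scalar_curvature A g m =
    dval ((contract (metric_at A g m) ^^ 2) (curvature_at A g m)) [] []"

definition h4 :: "('m, 'n::finite) chart set \<Rightarrow> ('m, 'n) metric \<Rightarrow> 'm \<Rightarrow> real"
  where "h4 A g m = 1 / fact 4 *
    dval ((contract (metric_at A g m) ^^ 4)
           (double_form_mult (curvature_at A g m) (curvature_at A g m))) [] []"

definition flat_on :: "'m set \<Rightarrow> ('m, 'n::finite) chart set \<Rightarrow> ('m, 'n) metric \<Rightarrow> bool"
  where "flat_on U A g \<longleftrightarrow>
    (\<forall>m\<in>U. \<forall>x y z w. dval (curvature_at A g m) [x, y] [z, w] = 0)"

definition einstein ::
  "'m topology \<Rightarrow> ('m, 'n::finite) chart set \<Rightarrow> ('m, 'n) metric \<Rightarrow> bool"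
  where "einstein X A g \<longleftrightarrow>
    (\<exists>\<kappa>::real. \<forall>m\<in>topspace X. \<forall>x y.
       dval (ricci_at A g m) [x] [y] = \<kappa> * ip (metric_at A g m) x y)"

text \<open>The metric \<open>exp (2 f) g\<close>.\<close>

definition conformal_metric ::
  "('m \<Rightarrow> real) \<Rightarrow> ('m, 'n::finite) metric \<Rightarrow> ('m, 'n) metric"
  where "conformal_metric f g = (\<lambda>c x. exp (2 * f (cinv c x)) *\<^sub>R g c x)"

definition conformally_flat ::
  "'m topology \<Rightarrow> ('m, 'n::finite) chart set \<Rightarrow> ('m, 'n) metric \<Rightarrow> bool"
  where "conformally_flat X A g \<longleftrightarrow>
    (\<forall>m\<in>topspace X. \<exists>U f. openin X U \<and> m \<in> U \<and>
       (\<forall>c\<in>A. smooth_on (cmap c ` (cdom c \<inter> U)) (f \<circ> cinv c)) \<and>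
       flat_on U A (conformal_metric f g))"

end

theory Submission
  imports Defs
begin

text \<open>
  At a point, expand \<open>R\<^sup>2\<close> in an orthonormal frame.  Since \<open>R\<close> is alternating in both pairs of arguments,
  the 576 terms of a full contraction of \<open>R\<^sup>2\<close> collapse to
  \<open>h\<^sub>4 = (s\<^sup>2 - 4 \<Sum> Ric\<^sub>b\<^sub>c Ric\<^sub>c\<^sub>b + \<Sum> R\<^sub>a\<^sub>b\<^sub>c\<^sub>d R\<^sub>c\<^sub>d\<^sub>a\<^sub>b) / 4\<close>.

  If \<open>Ric = \<kappa> g\<close>, the first two terms are \<open>n (n - 4) \<kappa>\<^sup>2 \<ge> 0\<close>, and by pair symmetry the last one is a sum of
  squares, so \<open>h\<^sub>4\<close> dominates a positive multiple of \<open>|R|\<^sup>2\<close>.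

  If \<open>exp (2 \<phi>) g\<close> is flat, the conformal transformation law of the curvature shows \<open>R = g \<cdot> P\<close> for a
  symmetric bilinear form \<open>P\<close>.  Vanishing scalar curvature forces \<open>tr P = 0\<close>, and then
  \<open>h\<^sub>4 = - (n - 2) (n - 3) |P|\<^sup>2\<close>.

  The symmetries of \<open>R\<close> and the conformal law are both read off from the lowered curvature
  \<open>\<partial>\<^sub>i \<Gamma>\<^sub>k\<^sub>,\<^sub>j\<^sub>l - \<partial>\<^sub>j \<Gamma>\<^sub>k\<^sub>,\<^sub>i\<^sub>l - \<Gamma>\<^sub>a\<^sub>,\<^sub>i\<^sub>k \<Gamma>\<^sup>a\<^sub>j\<^sub>l + \<Gamma>\<^sub>a\<^sub>,\<^sub>j\<^sub>k \<Gamma>\<^sup>a\<^sub>i\<^sub>l\<close>, in which only Christoffel symbols of the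
  first kind are differentiated, so the inverse metric is never differentiated explicitly.
\<close>

section \<open>Full contraction of the square of a double form\<close>

text \<open>The 24 permutations fall into six classes according to which two indices occupy the
  first pair of slots. Within a class the sign of the permutation cancels the sign changes of
  \<open>F\<close>, so its four members contribute equally.\<close>

lemma sum_permutations_alternating_pairs:
  fixes F :: "nat \<Rightarrow> nat \<Rightarrow> nat \<Rightarrow> nat \<Rightarrow> real"
  assumes swap1: "\<And>a b c d. F b a c d = - F a b c d"
    and swap2: "\<And>a b c d. F a b d c = - F a b c d"
  shows "(\<Sum>\<sigma> | \<sigma> permutes {..<4}. of_int (sign \<sigma>) * F (\<sigma> 0) (\<sigma> 1) (\<sigma> 2) (\<sigma> 3)) =
    4 * (F 0 1 2 3 - F 0 2 1 3 + F 0 3 1 2 + F 1 2 0 3 - F 1 3 0 2 + F 2 3 0 1)"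
proof -
  have set: "{..<4} = {0, 1, 2, 3::nat}" by auto
  have f0: "finite {1, 2, 3::nat}" "0 \<notin> {1, 2, 3::nat}" by auto
  have f1: "finite {2, 3::nat}" "1 \<notin> {2, 3::nat}" by auto
  have f2: "finite {3::nat}" "2 \<notin> {3::nat}" by auto
  \<comment> \<open>Only descending pairs of numerals are rewritten, so every term reaches a sorted
    normal form and the simplifier cannot loop.\<close>
  have neg: "F 1 0 c d = - F 0 1 c d" "F 2 0 c d = - F 0 2 c d" "F 3 0 c d = - F 0 3 c d"
    "F 2 1 c d = - F 1 2 c d" "F 3 1 c d = - F 1 3 c d" "F 3 2 c d = - F 2 3 c d"
    "F a b 1 0 = - F a b 0 1" "F a b 2 0 = - F a b 0 2" "F a b 3 0 = - F a b 0 3"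
    "F a b 2 1 = - F a b 1 2" "F a b 3 1 = - F a b 1 3" "F a b 3 2 = - F a b 2 3" for a b c d
    by (rule swap1 swap2)+
  show ?thesis
    \<comment> \<open>A permutation of \<open>insert a S\<close> is a transposition of
      \<open>a\<close> with some element after a permutation of \<open>S\<close>; peeling off 0, 1,
      2 in turn enumerates all 24.\<close>
    unfolding set
    unfolding sum_over_permutations_insert[OF f0]
    unfolding sum_over_permutations_insert[OF f1]
    unfolding sum_over_permutations_insert[OF f2]
    unfolding permutes_sing
    by (simp add: sign_swap_id permutation_swap_id sign_compose sign_id transpose_def
        permutation_compose neg neg[simplified])
qed

text \<open>A quarter of the alternation of \<open>w [x0, x1] [y0, y1] * w [x2, x3] [y2, y3]\<close> in the \<open>y\<close>'s.\<close>

definition pairing ::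
  "('v list \<Rightarrow> 'v list \<Rightarrow> real) \<Rightarrow> 'v \<Rightarrow> 'v \<Rightarrow> 'v \<Rightarrow> 'v \<Rightarrow> 'v \<Rightarrow> 'v \<Rightarrow> 'v \<Rightarrow> 'v \<Rightarrow> real"
  where "pairing w x0 x1 x2 x3 y0 y1 y2 y3 =
      w [x0, x1] [y0, y1] * w [x2, x3] [y2, y3] - w [x0, x1] [y0, y2] * w [x2, x3] [y1, y3]
    + w [x0, x1] [y0, y3] * w [x2, x3] [y1, y2] + w [x0, x1] [y1, y2] * w [x2, x3] [y0, y3]
    - w [x0, x1] [y1, y3] * w [x2, x3] [y0, y2] + w [x0, x1] [y2, y3] * w [x2, x3] [y0, y1]"

definition alternating2 :: "('v list \<Rightarrow> 'v list \<Rightarrow> real) \<Rightarrow> bool"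
  where "alternating2 w \<longleftrightarrow>
    (\<forall>x y z u. w [y, x] [z, u] = - w [x, y] [z, u] \<and> w [x, y] [u, z] = - w [x, y] [z, u])"

text \<open>Each of the two permutation sums collapses to six terms with a factor 4, and these
  factors cancel the normalisation \<open>fact 2 ^ 4 = 16\<close>.\<close>

lemma double_form_square:
  assumes "alternating2 w"
  shows "dval (double_form_mult (DForm 2 2 w) (DForm 2 2 w)) [x0, x1, x2, x3] [y0, y1, y2, y3] =
      pairing w x0 x1 x2 x3 y0 y1 y2 y3 - pairing w x0 x2 x1 x3 y0 y1 y2 y3
    + pairing w x0 x3 x1 x2 y0 y1 y2 y3 + pairing w x1 x2 x0 x3 y0 y1 y2 y3
    - pairing w x1 x3 x0 x2 y0 y1 y2 y3 + pairing w x2 x3 x0 x1 y0 y1 y2 y3"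
proof -
  have swap1: "w [y, x] [z, u] = - w [x, y] [z, u]" and swap2: "w [x, y] [u, z] = - w [x, y] [z, u]"
    for x y z u using assms unfolding alternating2_def by blast+
  \<comment> \<open>The arguments become functions of an index, the shape in which the sum over
    permutations was evaluated.\<close>
  define X where "X = (\<lambda>i. [x0, x1, x2, x3] ! i)"
  define Y where "Y = (\<lambda>i. [y0, y1, y2, y3] ! i)"
  have X: "X 0 = x0" "X (Suc 0) = x1" "X 2 = x2" "X 3 = x3" "X 1 = x1"
    and Y: "Y 0 = y0" "Y (Suc 0) = y1" "Y 2 = y2" "Y 3 = y3" "Y 1 = y1"
    by (simp_all add: X_def Y_def)
  have inner: "(\<Sum>\<tau> | \<tau> permutes {..<4}. of_int (sign \<tau>) *
        (w [a, b] [Y (\<tau> 0), Y (\<tau> 1)] * w [c, d] [Y (\<tau> 2), Y (\<tau> 3)])) =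
      4 * pairing w a b c d y0 y1 y2 y3" for a b c d
  proof (subst sum_permutations_alternating_pairs[where
        F = "\<lambda>i j k l. w [a, b] [Y i, Y j] * w [c, d] [Y k, Y l]"])
    show "w [a, b] [Y j, Y i] * w [c, d] [Y k, Y l] = - (w [a, b] [Y i, Y j] * w [c, d] [Y k, Y l])"
      for i j k l unfolding swap2[where z="Y i" and u="Y j"] by simp
    show "w [a, b] [Y i, Y j] * w [c, d] [Y l, Y k] = - (w [a, b] [Y i, Y j] * w [c, d] [Y k, Y l])"
      for i j k l unfolding swap2[where z="Y k" and u="Y l"] by simp
  qed (simp add: Y pairing_def)
  have outer: "(\<Sum>\<sigma> | \<sigma> permutes {..<4}. of_int (sign \<sigma>) *
        pairing w (X (\<sigma> 0)) (X (\<sigma> 1)) (X (\<sigma> 2)) (X (\<sigma> 3)) y0 y1 y2 y3) =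
      4 * (pairing w x0 x1 x2 x3 y0 y1 y2 y3 - pairing w x0 x2 x1 x3 y0 y1 y2 y3
    + pairing w x0 x3 x1 x2 y0 y1 y2 y3 + pairing w x1 x2 x0 x3 y0 y1 y2 y3
    - pairing w x1 x3 x0 x2 y0 y1 y2 y3 + pairing w x2 x3 x0 x1 y0 y1 y2 y3)"
  proof (subst sum_permutations_alternating_pairs[where
        F = "\<lambda>i j k l. pairing w (X i) (X j) (X k) (X l) y0 y1 y2 y3"])
    show "pairing w (X b) (X a) (X c) (X d) y0 y1 y2 y3 = - pairing w (X a) (X b) (X c) (X d) y0 y1 y2 y3"
      for a b c d
      unfolding pairing_def swap1[where x="X a" and y="X b"] by simp
    show "pairing w (X a) (X b) (X d) (X c) y0 y1 y2 y3 = - pairing w (X a) (X b) (X c) (X d) y0 y1 y2 y3"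
      for a b c d
      unfolding pairing_def swap1[where x="X c" and y="X d"] by simp
  qed (simp add: X)
  have "[0..<2] = [0, 1::nat]" "[2..<4] = [2, 3::nat]"
    by (simp_all add: upt_rec)
  then have "dval (double_form_mult (DForm 2 2 w) (DForm 2 2 w)) [x0, x1, x2, x3] [y0, y1, y2, y3] =
      (\<Sum>\<sigma> | \<sigma> permutes {..<4}. of_int (sign \<sigma>) *
        (\<Sum>\<tau> | \<tau> permutes {..<4}. of_int (sign \<tau>) *
        (w [X (\<sigma> 0), X (\<sigma> 1)] [Y (\<tau> 0), Y (\<tau> 1)] * w [X (\<sigma> 2), X (\<sigma> 3)] [Y (\<tau> 2), Y (\<tau> 3)]))) / 16"
    by (simp add: X_def Y_def sum_distrib_left mult.assoc fact_numeral)
  also have "\<dots> = (\<Sum>\<sigma> | \<sigma> permutes {..<4}. of_int (sign \<sigma>) *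
        pairing w (X (\<sigma> 0)) (X (\<sigma> 1)) (X (\<sigma> 2)) (X (\<sigma> 3)) y0 y1 y2 y3) * 4 / 16"
    unfolding inner by (simp add: sum_distrib_left sum_distrib_right mult_ac)
  finally show ?thesis
    unfolding outer by simp
qed

text \<open>The frame chosen in \<open>contract\<close> depends only on \<open>G\<close>, so
  iterated contractions all sum over one and the same frame.\<close>

lemma contract_power_2:
  "dval ((contract G ^^ 2) (DForm 2 2 w)) [] [] =
    (let e = (SOME e. orthonormal_frame G e) in \<Sum>b\<in>UNIV. \<Sum>a\<in>UNIV. w [e a, e b] [e a, e b])"
  by (simp add: numeral_2_eq_2 Let_def)

lemma contract_power_4:
  "dval ((contract G ^^ 4) (DForm 4 4 w)) [] [] =
    (let e = (SOME e. orthonormal_frame G e)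
     in \<Sum>d\<in>UNIV. \<Sum>c\<in>UNIV. \<Sum>b\<in>UNIV. \<Sum>a\<in>UNIV. w [e a, e b, e c, e d] [e a, e b, e c, e d])"
  by (simp add: eval_nat_numeral Let_def)

text \<open>After summation over the frame, the six pairings of \<open>double_form_square\<close>
  agree up to a sign that matches their coefficient, so they add up to 6 times one of them, and 6 /
  4! leaves 1/4. That pairing has six products: one gives the squared scalar curvature, four a
  product of Ricci terms, and one the full contraction.\<close>

lemma full_contraction_square:
  fixes G :: "real ^ 'n ^ 'n"
  assumes alt: "alternating2 w"
  defines "e \<equiv> (SOME e. orthonormal_frame G e)"
  defines "r \<equiv> \<lambda>a b c d. w [e a, e b] [e c, e d]"
  defines "Ric \<equiv> \<lambda>b c. \<Sum>a\<in>UNIV. r a b a c"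
  shows "1 / fact 4 * dval ((contract G ^^ 4) (double_form_mult (DForm 2 2 w) (DForm 2 2 w))) [] [] =
    ((\<Sum>b\<in>UNIV. Ric b b)\<^sup>2 - 4 * (\<Sum>b\<in>UNIV. \<Sum>c\<in>UNIV. Ric b c * Ric c b)
      + (\<Sum>a\<in>UNIV. \<Sum>b\<in>UNIV. \<Sum>c\<in>UNIV. \<Sum>d\<in>UNIV. r a b c d * r c d a b)) / 4"
proof -
  have swap1: "w [y, x] [z, u] = - w [x, y] [z, u]" and swap2: "w [x, y] [u, z] = - w [x, y] [z, u]"
    for x y z u using alt unfolding alternating2_def by blast+
  define P where "P = (\<lambda>a b c d a' b' c' d'. pairing w (e a) (e b) (e c) (e d) (e a') (e b') (e c') (e d'))"
  define S where "S = (\<lambda>F :: 'n \<Rightarrow> 'n \<Rightarrow> 'n \<Rightarrow> 'n \<Rightarrow> real.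
    \<Sum>d\<in>UNIV. \<Sum>c\<in>UNIV. \<Sum>b\<in>UNIV. \<Sum>a\<in>UNIV. F a b c d)"
  have S01: "S (\<lambda>a b c d. F b a c d) = S F" for F
  proof -
    have "(\<Sum>b\<in>UNIV. \<Sum>a\<in>UNIV. F b a c d) = (\<Sum>b\<in>UNIV. \<Sum>a\<in>UNIV. F a b c d)" for c d
      by (rule sum.swap)
    then show ?thesis by (simp only: S_def)
  qed
  have S12: "S (\<lambda>a b c d. F a c b d) = S F" for F
  proof -
    have "(\<Sum>c\<in>UNIV. \<Sum>b\<in>UNIV. \<Sum>a\<in>UNIV. F a c b d) = (\<Sum>c\<in>UNIV. \<Sum>b\<in>UNIV. \<Sum>a\<in>UNIV. F a b c d)" for d
      by (rule sum.swap)
    then show ?thesis by (simp only: S_def)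
  qed
  have S23: "S (\<lambda>a b c d. F a b d c) = S F" for F
    unfolding S_def by (rule sum.swap)
  have Sneg: "S (\<lambda>a b c d. - F a b c d) = - S F" for F
    by (simp add: S_def sum_negf)
  \<comment> \<open>The first four arguments may be any functions of the summation indices, so that
    one sign rule serves all the arrangements below.\<close>
  have P01: "S (\<lambda>a b c d. P (i a b c d) (j a b c d) (k a b c d) (l a b c d) b a c d) =
      - S (\<lambda>a b c d. P (i a b c d) (j a b c d) (k a b c d) (l a b c d) a b c d)" for i j k l
  proof -
    have "P i j k l b a c d = - P i j k l a b c d" for i j k l a b c d
      unfolding P_def pairing_def swap2[where z="e a" and u="e b"] by simp
    then show ?thesis
      unfolding Sneg[symmetric] by (intro arg_cong[where f = S] ext)
  qed
  have P12: "S (\<lambda>a b c d. P (i a b c d) (j a b c d) (k a b c d) (l a b c d) a c b d) =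
      - S (\<lambda>a b c d. P (i a b c d) (j a b c d) (k a b c d) (l a b c d) a b c d)" for i j k l
  proof -
    have "P i j k l a c b d = - P i j k l a b c d" for i j k l a b c d
      unfolding P_def pairing_def swap2[where z="e b" and u="e c"] by simp
    then show ?thesis
      unfolding Sneg[symmetric] by (intro arg_cong[where f = S] ext)
  qed
  have P23: "S (\<lambda>a b c d. P (i a b c d) (j a b c d) (k a b c d) (l a b c d) a b d c) =
      - S (\<lambda>a b c d. P (i a b c d) (j a b c d) (k a b c d) (l a b c d) a b c d)" for i j k l
  proof -
    have "P i j k l a b d c = - P i j k l a b c d" for i j k l a b c d
      unfolding P_def pairing_def swap2[where z="e c" and u="e d"] by simp
    then show ?thesis
      unfolding Sneg[symmetric] by (intro arg_cong[where f = S] ext)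
  qed
  \<comment> \<open>Each arrangement comes from an earlier one by exchanging two adjacent summation
    indices. The exchange also permutes the last four arguments, and undoing that costs a
    sign.\<close>
  have acbd: "S (\<lambda>a b c d. P a c b d a b c d) = - S (\<lambda>a b c d. P a b c d a b c d)"
    using S12[of "\<lambda>a b c d. P a b c d a c b d"] P12[of "\<lambda>a b c d. a" "\<lambda>a b c d. b" "\<lambda>a b c d. c" "\<lambda>a b c d. d"] by simp
  have adbc: "S (\<lambda>a b c d. P a d b c a b c d) = S (\<lambda>a b c d. P a b c d a b c d)"
    using S23[of "\<lambda>a b c d. P a c b d a b d c"] P23[of "\<lambda>a b c d. a" "\<lambda>a b c d. c" "\<lambda>a b c d. b" "\<lambda>a b c d. d"] acbd by simp
  have bcad: "S (\<lambda>a b c d. P b c a d a b c d) = S (\<lambda>a b c d. P a b c d a b c d)"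
    using S01[of "\<lambda>a b c d. P a c b d b a c d"] P01[of "\<lambda>a b c d. a" "\<lambda>a b c d. c" "\<lambda>a b c d. b" "\<lambda>a b c d. d"] acbd by simp
  have bdac: "S (\<lambda>a b c d. P b d a c a b c d) = - S (\<lambda>a b c d. P a b c d a b c d)"
    using S01[of "\<lambda>a b c d. P a d b c b a c d"] P01[of "\<lambda>a b c d. a" "\<lambda>a b c d. d" "\<lambda>a b c d. b" "\<lambda>a b c d. c"] adbc by simp
  have cdab: "S (\<lambda>a b c d. P c d a b a b c d) = S (\<lambda>a b c d. P a b c d a b c d)"
    using S12[of "\<lambda>a b c d. P b d a c a c b d"] P12[of "\<lambda>a b c d. b" "\<lambda>a b c d. d" "\<lambda>a b c d. a" "\<lambda>a b c d. c"] bdac by simp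
  have six: "dval ((contract G ^^ 4) (double_form_mult (DForm 2 2 w) (DForm 2 2 w))) [] [] =
      6 * S (\<lambda>a b c d. P a b c d a b c d)"
  proof -
    obtain v where v: "double_form_mult (DForm 2 2 w) (DForm 2 2 w) = DForm 4 4 v"
      by simp
    have "v [e a, e b, e c, e d] [e a, e b, e c, e d] =
        P a b c d a b c d - P a c b d a b c d + P a d b c a b c d
        + P b c a d a b c d - P b d a c a b c d + P c d a b a b c d" for a b c d
      using double_form_square[OF alt, of "e a" "e b" "e c" "e d" "e a" "e b" "e c" "e d"]
      unfolding v by (simp add: P_def)
    then have "dval ((contract G ^^ 4) (DForm 4 4 v)) [] [] =
        S (\<lambda>a b c d. P a b c d a b c d) - S (\<lambda>a b c d. P a c b d a b c d)
        + S (\<lambda>a b c d. P a d b c a b c d) + S (\<lambda>a b c d. P b c a d a b c d)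
        - S (\<lambda>a b c d. P b d a c a b c d) + S (\<lambda>a b c d. P c d a b a b c d)"
      unfolding contract_power_4 e_def[symmetric] Let_def
      by (simp add: S_def sum.distrib sum_subtractf)
    then show ?thesis
      unfolding v acbd adbc bcad bdac cdab by simp
  qed
  have r1: "r b a c d = - r a b c d" and r2: "r a b d c = - r a b c d" for a b c d
    unfolding r_def by (rule swap1, rule swap2)
  \<comment> \<open>Signs are moved so that in the four mixed products each factor repeats an index
    in its first and third slots, where a sum over it produces \<open>Ric\<close>.\<close>
  have P_r: "P a b c d a b c d =
      r a b a b * r c d c d - r a b a c * r d c d b - r b a b d * r c d c a
      - r a b a d * r c d c b - r b a b c * r d c d a + r a b c d * r c d a b" for a b c d
    using r1[of c d b d] r2[of d c b d] r1[of c d a d] r2[of d c a d] r2[of c d b c] r2[of c d a c]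
      r1[of a b b c] r1[of a b b d]
    unfolding P_def pairing_def r_def by simp
  have prod: "S (\<lambda>a b c d. r a b a b * r c d c d) = (\<Sum>b\<in>UNIV. Ric b b)\<^sup>2"
    by (simp add: S_def Ric_def power2_eq_square flip: sum_distrib_left sum_distrib_right)
  define K where "K = (\<Sum>b\<in>UNIV. \<Sum>c\<in>UNIV. Ric b c * Ric c b)"
  have ric1: "S (\<lambda>a b c d. r a b a c * r d c d b) = K"
  proof -
    have "S (\<lambda>a b c d. r a b a c * r d c d b) = (\<Sum>d\<in>UNIV. \<Sum>c\<in>UNIV. \<Sum>b\<in>UNIV. Ric b c * r d c d b)"
      by (simp add: S_def Ric_def flip: sum_distrib_right)
    also have "\<dots> = (\<Sum>c\<in>UNIV. \<Sum>d\<in>UNIV. \<Sum>b\<in>UNIV. Ric b c * r d c d b)"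
      by (rule sum.swap)
    also have "\<dots> = (\<Sum>c\<in>UNIV. \<Sum>b\<in>UNIV. \<Sum>d\<in>UNIV. Ric b c * r d c d b)"
      by (rule sum.cong[OF refl], rule sum.swap)
    also have "\<dots> = (\<Sum>c\<in>UNIV. \<Sum>b\<in>UNIV. Ric b c * Ric c b)"
      unfolding Ric_def by (simp only: sum_distrib_left)
    also have "\<dots> = K"
      by (simp add: K_def mult.commute)
    finally show ?thesis .
  qed
  have ric2: "S (\<lambda>a b c d. r a b a d * r c d c b) = K"
    using S23[of "\<lambda>a b c d. r a b a c * r d c d b"] ric1 by simp
  have ric3: "S (\<lambda>a b c d. r b a b c * r d c d a) = K"
    using S01[of "\<lambda>a b c d. r a b a c * r d c d b"] ric1 by simp
  have ric4: "S (\<lambda>a b c d. r b a b d * r c d c a) = K"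
    using S23[of "\<lambda>a b c d. r b a b c * r d c d a"] ric3 by simp
  have full: "S (\<lambda>a b c d. r a b c d * r c d a b) =
      (\<Sum>a\<in>UNIV. \<Sum>b\<in>UNIV. \<Sum>c\<in>UNIV. \<Sum>d\<in>UNIV. r a b c d * r c d a b)"
  proof -
    \<comment> \<open>\<open>S\<close> sums over its indices in reverse order, so after renaming
      bound variables the claim is invariance of the summand under reversal of all four indices; the
      four sign changes cancel.\<close>
    have "r d c b a * r b a d c = r a b c d * r c d a b" for a b c d
      using r1[of c d b a] r1[of a b d c] r2[of c d a b] r2[of a b c d] by simp
    then show ?thesis
      by (simp add: S_def)
  qed
  have "S (\<lambda>a b c d. P a b c d a b c d) = (\<Sum>b\<in>UNIV. Ric b b)\<^sup>2 - 4 * K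
      + (\<Sum>a\<in>UNIV. \<Sum>b\<in>UNIV. \<Sum>c\<in>UNIV. \<Sum>d\<in>UNIV. r a b c d * r c d a b)"
    unfolding P_r prod[symmetric] full[symmetric]
    using ric1 ric2 ric3 ric4 by (simp add: S_def sum.distrib sum_subtractf)
  then show ?thesis
    unfolding six K_def by (simp add: fact_numeral)
qed

section \<open>Partial derivatives\<close>

lemma pderivative_eqI:
  "(f has_derivative f') (at x) \<Longrightarrow> pderivative i f x = f' (axis i 1)"
  unfolding pderivative_def using frechet_derivative_at by metis

lemma has_derivative_frechet:
  "f differentiable (at x) \<Longrightarrow> (f has_derivative frechet_derivative f (at x)) (at x)"
  by (simp add: frechet_derivative_works)

lemma pderivative_add:
  assumes "f differentiable (at x)" "g differentiable (at x)"
  shows "pderivative i (\<lambda>y. f y + g y) x = pderivative i f x + pderivative i g x"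
  using pderivative_eqI[OF has_derivative_add[OF assms[THEN has_derivative_frechet]]]
  by (simp add: pderivative_def)

lemma pderivative_diff:
  assumes "f differentiable (at x)" "g differentiable (at x)"
  shows "pderivative i (\<lambda>y. f y - g y) x = pderivative i f x - pderivative i g x"
  using pderivative_eqI[OF has_derivative_diff[OF assms[THEN has_derivative_frechet]]]
  by (simp add: pderivative_def)

lemma pderivative_mult:
  assumes "f differentiable (at x)" "g differentiable (at x)"
  shows "pderivative i (\<lambda>y. f y * g y) x = f x * pderivative i g x + pderivative i f x * g x"
  using pderivative_eqI[OF has_derivative_mult[OF assms[THEN has_derivative_frechet]]]
  by (simp add: pderivative_def)

lemma pderivative_const_mult:
  assumes "f differentiable (at x)"
  shows "pderivative i (\<lambda>y. c * f y) x = c * pderivative i f x"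
  using pderivative_eqI[OF has_derivative_mult_right[OF has_derivative_frechet[OF assms]]]
  by (simp add: pderivative_def)

lemma pderivative_sum:
  assumes "\<And>a. a \<in> I \<Longrightarrow> f a differentiable (at x)"
  shows "pderivative i (\<lambda>y. \<Sum>a\<in>I. f a y) x = (\<Sum>a\<in>I. pderivative i (f a) x)"
  using pderivative_eqI[OF has_derivative_sum[where I = I, OF has_derivative_frechet[OF assms]]]
  by (simp add: pderivative_def)

lemma pderivative_exp:
  assumes "f differentiable (at x)"
  shows "pderivative i (\<lambda>y. exp (f y)) x = exp (f x) * pderivative i f x"
  using pderivative_eqI[OF has_derivative_exp[OF has_derivative_frechet[OF assms]]]
  by (simp add: pderivative_def)

lemma differentiable_exp:
  fixes f :: "'a::real_normed_vector \<Rightarrow> real"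
  assumes "f differentiable (at x)"
  shows "(\<lambda>y. exp (f y)) differentiable (at x)"
  using has_derivative_exp[OF assms[unfolded frechet_derivative_works]] differentiableI by blast

text \<open>Identities between metric components hold only on the open coordinate domain; locality
  of the derivative is what allows them to be differentiated.\<close>

lemma pderivative_cong_open:
  assumes "open S" "x \<in> S" "\<And>y. y \<in> S \<Longrightarrow> f y = g y"
  shows "pderivative i f x = pderivative i g x"
proof -
  have "(f has_derivative F) (at x) \<longleftrightarrow> (g has_derivative F) (at x)" for F
    using assms by (metis has_derivative_transform_within_open)
  then show ?thesis
    by (simp add: pderivative_def frechet_derivative_def)
qed

lemma differentiable_cong_open:
  assumes "f differentiable (at x)" "open S" "x \<in> S" "\<And>y. y \<in> S \<Longrightarrow> f y = g y"
  shows "g differentiable (at x)"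
  using assms has_derivative_transform_within_open unfolding differentiable_def by blast

section \<open>Equality of mixed second partial derivatives\<close>

lemma has_real_derivative_along_axis:
  assumes "f differentiable (at (y + s *\<^sub>R axis i 1))"
  shows "((\<lambda>s. f (y + s *\<^sub>R axis i 1)) has_real_derivative
    pderivative i f (y + s *\<^sub>R axis i 1)) (at s)"
proof -
  define F where "F = frechet_derivative f (at (y + s *\<^sub>R axis i 1))"
  have F: "(f has_derivative F) (at (y + s *\<^sub>R axis i 1))"
    using has_derivative_frechet[OF assms] by (simp add: F_def)
  have "((\<lambda>s. y + s *\<^sub>R axis i 1) has_derivative (\<lambda>t. t *\<^sub>R axis i 1)) (at s)"
    by (auto intro!: derivative_eq_intros)
  from has_derivative_compose[OF this F]
  have "((\<lambda>s. f (y + s *\<^sub>R axis i 1)) has_derivative (\<lambda>t. F (t *\<^sub>R axis i 1))) (at s)" .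
  moreover have "F (t *\<^sub>R axis i 1) = F (axis i 1) * t" for t
    using has_derivative_linear[OF F] by (simp add: linear_cmul)
  ultimately show ?thesis
    by (simp add: has_field_derivative_def pderivative_def F_def)
qed

text \<open>The mean value theorem is applied twice: along axis \<open>i\<close> to the difference
  of \<open>f\<close> on two opposite edges of the square, then along axis \<open>j\<close> to the
  partial derivative so obtained.\<close>

lemma second_difference_mvt:
  fixes f :: "real ^ 'n \<Rightarrow> real"
  assumes h: "0 < h"
    and in_S: "\<And>s t. 0 \<le> s \<Longrightarrow> s \<le> h \<Longrightarrow> 0 \<le> t \<Longrightarrow> t \<le> h \<Longrightarrow>
      x + s *\<^sub>R axis i 1 + t *\<^sub>R axis j 1 \<in> S"
    and diff: "\<And>y. y \<in> S \<Longrightarrow> f differentiable (at y)"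
    and diff': "\<And>y. y \<in> S \<Longrightarrow> pderivative i f differentiable (at y)"
  shows "\<exists>s t. 0 < s \<and> s < h \<and> 0 < t \<and> t < h \<and>
    f (x + h *\<^sub>R axis i 1 + h *\<^sub>R axis j 1) - f (x + h *\<^sub>R axis i 1) - f (x + h *\<^sub>R axis j 1) + f x =
    h * h * pderivative j (pderivative i f) (x + s *\<^sub>R axis i 1 + t *\<^sub>R axis j 1)"
proof -
  define a b :: "real ^ 'n" where "a = axis i 1" and "b = axis j 1"
  have "((\<lambda>s. f (x + h *\<^sub>R b + s *\<^sub>R a) - f (x + s *\<^sub>R a)) has_real_derivative
      pderivative i f (x + h *\<^sub>R b + s *\<^sub>R a) - pderivative i f (x + s *\<^sub>R a)) (at s)"
    if "0 \<le> s" "s \<le> h" for s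
    unfolding a_def b_def
    using in_S[of s h] in_S[of s 0] that h
    by (intro DERIV_diff has_real_derivative_along_axis diff) (simp_all add: add_ac)
  from MVT2[OF h this] obtain s where s: "0 < s" "s < h" and
    eq1: "(f (x + h *\<^sub>R b + h *\<^sub>R a) - f (x + h *\<^sub>R a)) - (f (x + h *\<^sub>R b) - f x) =
      h * (pderivative i f (x + h *\<^sub>R b + s *\<^sub>R a) - pderivative i f (x + s *\<^sub>R a))"
    by auto
  have "((\<lambda>t. pderivative i f (x + s *\<^sub>R a + t *\<^sub>R b)) has_real_derivative
      pderivative j (pderivative i f) (x + s *\<^sub>R a + t *\<^sub>R b)) (at t)"
    if "0 \<le> t" "t \<le> h" for t
    unfolding a_def b_def
    using in_S[of s t] that s
    by (intro has_real_derivative_along_axis diff') simp_all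
  from MVT2[OF h this] obtain t where t: "0 < t" "t < h" and
    eq2: "pderivative i f (x + s *\<^sub>R a + h *\<^sub>R b) - pderivative i f (x + s *\<^sub>R a) =
      h * pderivative j (pderivative i f) (x + s *\<^sub>R a + t *\<^sub>R b)"
    by auto
  show ?thesis
    using s t eq1 eq2 unfolding a_def b_def
    by (intro exI[of _ s] exI[of _ t]) (simp add: add_ac)
qed

text \<open>The second difference over a small square is symmetric in \<open>i\<close> and
  \<open>j\<close>, so the two mixed derivatives take a common value at points of the square; by
  continuity at \<open>x\<close> they agree there.\<close>

lemma pderivative_commute:
  fixes f :: "real ^ 'n \<Rightarrow> real"
  assumes S: "open S" "x \<in> S" and f: "Ck_on 2 S f"
  shows "pderivative i (pderivative j f) x = pderivative j (pderivative i f) x"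
proof (rule ccontr)
  assume ne: "\<not> ?thesis"
  have diff: "\<And>y. y \<in> S \<Longrightarrow> f differentiable (at y)"
    and diff': "\<And>y k. y \<in> S \<Longrightarrow> pderivative k f differentiable (at y)"
    and cont: "\<And>k l. continuous_on S (pderivative k (pderivative l f))"
    using f by (auto simp: numeral_2_eq_2)
  \<comment> \<open>With half the gap as tolerance, a common value within \<open>\<epsilon>\<close>
    of both limits contradicts the triangle inequality.\<close>
  define \<epsilon> where "\<epsilon> = \<bar>pderivative i (pderivative j f) x - pderivative j (pderivative i f) x\<bar> / 2"
  have "\<epsilon> > 0"
    using ne by (simp add: \<epsilon>_def)
  have near: "\<exists>d>0. \<forall>y\<in>S. dist y x < d \<longrightarrow>
      \<bar>pderivative k (pderivative l f) y - pderivative k (pderivative l f) x\<bar> < \<epsilon>" for k l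
    using cont[of k l] S \<open>\<epsilon> > 0\<close> unfolding continuous_on_iff dist_real_def by blast
  obtain d1 where d1: "d1 > 0" "\<And>y. y \<in> S \<Longrightarrow> dist y x < d1 \<Longrightarrow>
      \<bar>pderivative i (pderivative j f) y - pderivative i (pderivative j f) x\<bar> < \<epsilon>"
    using near by blast
  obtain d2 where d2: "d2 > 0" "\<And>y. y \<in> S \<Longrightarrow> dist y x < d2 \<Longrightarrow>
      \<bar>pderivative j (pderivative i f) y - pderivative j (pderivative i f) x\<bar> < \<epsilon>"
    using near by blast
  obtain d3 where d3: "d3 > 0" "ball x d3 \<subseteq> S"
    using S open_contains_ball by blast
  \<comment> \<open>Points of the square of side \<open>h\<close> lie within \<open>2 * h\<close> of
    \<open>x\<close>, so a third of the smallest radius keeps them strictly inside all three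
    balls.\<close>
  define h where "h = min d1 (min d2 d3) / 3"
  have h: "h > 0" "2 * h < d1" "2 * h < d2" "2 * h < d3"
    using d1(1) d2(1) d3(1) by (auto simp: h_def)
  have close: "dist (x + s *\<^sub>R axis k 1 + t *\<^sub>R axis l 1) x \<le> 2 * h"
    if "0 \<le> s" "s \<le> h" "0 \<le> t" "t \<le> h" for s t and k l :: 'n
  proof -
    have "norm (s *\<^sub>R axis k (1::real) + t *\<^sub>R axis l 1) \<le> \<bar>s\<bar> + \<bar>t\<bar>"
      by (rule order_trans[OF norm_triangle_ineq]) (simp add: norm_eq_1[THEN iffD2] inner_axis_axis)
    then show ?thesis
      using that by (simp add: dist_norm add.assoc)
  qed
  have in_S: "x + s *\<^sub>R axis k 1 + t *\<^sub>R axis l 1 \<in> S"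
    if "0 \<le> s" "s \<le> h" "0 \<le> t" "t \<le> h" for s t and k l :: 'n
    using close[OF that, of k l] h(4) d3(2) by (force simp: dist_commute)
  obtain s t where st: "0 < s" "s < h" "0 < t" "t < h" and
    eq: "f (x + h *\<^sub>R axis i 1 + h *\<^sub>R axis j 1) - f (x + h *\<^sub>R axis i 1) - f (x + h *\<^sub>R axis j 1) + f x =
      h * h * pderivative j (pderivative i f) (x + s *\<^sub>R axis i 1 + t *\<^sub>R axis j 1)"
    using second_difference_mvt[OF h(1) in_S diff diff'] by blast
  obtain s' t' where st': "0 < s'" "s' < h" "0 < t'" "t' < h" and
    eq': "f (x + h *\<^sub>R axis j 1 + h *\<^sub>R axis i 1) - f (x + h *\<^sub>R axis j 1) - f (x + h *\<^sub>R axis i 1) + f x =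
      h * h * pderivative i (pderivative j f) (x + s' *\<^sub>R axis j 1 + t' *\<^sub>R axis i 1)"
    using second_difference_mvt[OF h(1) in_S diff diff'] by blast
  let ?y = "x + s *\<^sub>R axis i 1 + t *\<^sub>R axis j 1" and ?y' = "x + s' *\<^sub>R axis j 1 + t' *\<^sub>R axis i 1"
  have comm: "x + h *\<^sub>R axis j 1 + h *\<^sub>R axis i 1 = x + h *\<^sub>R axis i 1 + h *\<^sub>R axis j 1"
    by (simp add: add_ac)
  have "h * h * pderivative j (pderivative i f) ?y = h * h * pderivative i (pderivative j f) ?y'"
    using eq eq'[unfolded comm] by linarith
  then have "pderivative j (pderivative i f) ?y = pderivative i (pderivative j f) ?y'"
    using h(1) by simp
  moreover have "\<bar>pderivative j (pderivative i f) ?y - pderivative j (pderivative i f) x\<bar> < \<epsilon>"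
    using close[of s t i j] st h by (intro d2(2) in_S) auto
  moreover have "\<bar>pderivative i (pderivative j f) ?y' - pderivative i (pderivative j f) x\<bar> < \<epsilon>"
    using close[of s' t' j i] st' h by (intro d1(2) in_S) auto
  ultimately show False
    using abs_triangle_ineq4[of "pderivative j (pderivative i f) ?y - pderivative j (pderivative i f) x"
        "pderivative j (pderivative i f) ?y - pderivative i (pderivative j f) x"]
    by (simp add: \<epsilon>_def)
qed

section \<open>Differentiability of the inverse matrix\<close>

lemma matrix_inv_inverse:
  assumes "invertible A"
  shows "A ** matrix_inv A = mat 1 \<and> matrix_inv A ** A = mat 1"
  using assms unfolding invertible_def matrix_inv_def by (rule someI_ex)

text \<open>Column \<open>l\<close> of the inverse solves the linear system with right-hand side
  \<open>axis l 1\<close>. Cramer's rule turns its entries into quotients of determinants, which are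
  visibly differentiable.\<close>

lemma matrix_inv_component_cramer:
  fixes A :: "real ^ 'n ^ 'n"
  assumes "invertible A"
  shows "matrix_inv A $ k $ l = det (\<chi> i j. if j = k then axis l 1 $ i else A $ i $ j) / det A"
proof -
  have "A *v (matrix_inv A *v axis l 1) = axis l 1"
    using assms by (simp add: matrix_vector_mul_assoc matrix_inv_inverse)
  then have "matrix_inv A *v axis l 1 =
      (\<chi> k. det (\<chi> i j. if j = k then axis l 1 $ i else A $ i $ j) / det A)"
    using cramer[of A "matrix_inv A *v axis l 1" "axis l 1"] assms invertible_det_nz by blast
  moreover have "(matrix_inv A *v axis l 1) $ k = matrix_inv A $ k $ l"
    by (simp add: matrix_vector_mult_basis column_def)
  ultimately show ?thesis
    by (metis (no_types, lifting) vec_lambda_beta)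
qed

lemma differentiable_prod:
  fixes f :: "'i \<Rightarrow> 'a::real_normed_vector \<Rightarrow> real"
  assumes "\<And>i. i \<in> I \<Longrightarrow> f i differentiable (at x)"
  shows "(\<lambda>y. \<Prod>i\<in>I. f i y) differentiable (at x)"
  using has_derivative_prod[of I f, OF has_derivative_frechet[OF assms]] differentiableI by blast

lemma differentiable_det:
  fixes A :: "'a::real_normed_vector \<Rightarrow> real ^ 'n ^ 'n"
  assumes "\<And>i j. (\<lambda>y. A y $ i $ j) differentiable (at x)"
  shows "(\<lambda>y. det (A y)) differentiable (at x)"
  unfolding det_def using assms
  by (intro differentiable_sum ballI differentiable_mult differentiable_prod differentiable_const finite_permutations) simp_all

lemma differentiable_matrix_inv:
  fixes A :: "'a::real_normed_vector \<Rightarrow> real ^ 'n ^ 'n"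
  assumes "open S" "x \<in> S" "\<And>y. y \<in> S \<Longrightarrow> invertible (A y)"
    and A: "\<And>i j. (\<lambda>y. A y $ i $ j) differentiable (at x)"
  shows "(\<lambda>y. matrix_inv (A y) $ k $ l) differentiable (at x)"
proof (rule differentiable_cong_open[OF _ assms(1,2)])
  have "(\<lambda>y. if j = k then axis l 1 $ i else A y $ i $ j) differentiable (at x)" for i j
    using A by (cases "j = k") simp_all
  then show "(\<lambda>y. det (\<chi> i j. if j = k then axis l 1 $ i else A y $ i $ j) / det (A y)) differentiable (at x)"
    using assms(2,3) A by (intro differentiable_divide differentiable_det) (simp_all add: invertible_det_nz)
qed (simp add: assms(3) matrix_inv_component_cramer)

section \<open>The lowered curvature tensor in coordinates\<close>

text \<open>The Christoffel symbol of the first kind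
  \<open>\<Gamma>\<^sub>k\<^sub>,\<^sub>i\<^sub>j\<close>.\<close>

definition christoffel1 ::
  "(real ^ 'n \<Rightarrow> real ^ 'n ^ 'n) \<Rightarrow> 'n \<Rightarrow> 'n \<Rightarrow> 'n \<Rightarrow> real ^ 'n::finite \<Rightarrow> real"
  where "christoffel1 G k i j x = 1 / 2 *
    (pderivative i (\<lambda>y. G y $ j $ k) x + pderivative j (\<lambda>y. G y $ i $ k) x
      - pderivative k (\<lambda>y. G y $ i $ j) x)"

text \<open>This is \<open>g(R(\<partial>\<^sub>i, \<partial>\<^sub>j)\<partial>\<^sub>l,
  \<partial>\<^sub>k)\<close>, with the index order of \<open>coord_curvature\<close>.\<close>

definition lowered_curvature ::
  "(real ^ 'n \<Rightarrow> real ^ 'n ^ 'n) \<Rightarrow> 'n \<Rightarrow> 'n \<Rightarrow> 'n \<Rightarrow> 'n \<Rightarrow> real ^ 'n::finite \<Rightarrow> real"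
  where "lowered_curvature G i j k l x = (\<Sum>a\<in>UNIV. G x $ k $ a * riemann_op G a i j l x)"

text \<open>The regularity is kept low enough to pass directly to a conformally scaled metric;
  continuity of second derivatives enters only in \<open>coord_metric_C2\<close>.\<close>

locale coord_metric =
  fixes S :: "(real ^ 'n::finite) set" and G :: "real ^ 'n \<Rightarrow> real ^ 'n ^ 'n"
  assumes open_S: "open S"
    and diff: "\<And>x i j. x \<in> S \<Longrightarrow> (\<lambda>y. G y $ i $ j) differentiable (at x)"
    and diff': "\<And>x i j k. x \<in> S \<Longrightarrow> pderivative k (\<lambda>y. G y $ i $ j) differentiable (at x)"
    and sym: "\<And>x i j. x \<in> S \<Longrightarrow> G x $ j $ i = G x $ i $ j"
    and inv: "\<And>x. x \<in> S \<Longrightarrow> invertible (G x)"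
begin

lemma pderivative_sym:
  assumes "x \<in> S"
  shows "pderivative k (\<lambda>y. G y $ j $ i) x = pderivative k (\<lambda>y. G y $ i $ j) x"
  using open_S assms by (rule pderivative_cong_open) (rule sym)

text \<open>By nondegeneracy, identities for Christoffel symbols of the second kind may be checked
  after lowering an index.\<close>

lemma lower_inject:
  assumes x: "x \<in> S"
    and eq: "\<And>l. (\<Sum>k\<in>UNIV. G x $ l $ k * c k) = (\<Sum>k\<in>UNIV. G x $ l $ k * d k)"
  shows "c k = d k"
proof -
  have "G x *v (\<chi> k. c k) = G x *v (\<chi> k. d k)"
    using eq by (simp add: vec_eq_iff matrix_vector_mult_def)
  then have "matrix_inv (G x) ** G x *v (\<chi> k. c k) = matrix_inv (G x) ** G x *v (\<chi> k. d k)"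
    by (simp flip: matrix_vector_mul_assoc)
  then show ?thesis
    using matrix_inv_inverse[OF inv[OF x]] by (simp add: vec_eq_iff)
qed

lemma lower_raise:
  assumes "x \<in> S"
  shows "(\<Sum>k\<in>UNIV. G x $ l $ k * (\<Sum>m\<in>UNIV. matrix_inv (G x) $ k $ m * c m)) = c l"
proof -
  have "G x *v (matrix_inv (G x) *v (\<chi> m. c m)) = (\<chi> m. c m)"
    using matrix_inv_inverse[OF inv[OF assms]] by (simp add: matrix_vector_mul_assoc)
  from arg_cong[OF this, of "\<lambda>v. v $ l"] show ?thesis
    by (simp add: matrix_vector_mult_def)
qed

lemma lower_christoffel:
  "x \<in> S \<Longrightarrow> (\<Sum>k\<in>UNIV. G x $ l $ k * christoffel G k i j x) = christoffel1 G l i j x"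
  using lower_raise[of x l "\<lambda>m. christoffel1 G m i j x"]
  by (simp add: christoffel_def christoffel1_def sum_distrib_left mult.left_commute)

lemma christoffel1_commute: "x \<in> S \<Longrightarrow> christoffel1 G k j i x = christoffel1 G k i j x"
  by (simp add: christoffel1_def pderivative_sym[of x k j i])

lemma christoffel_commute: "x \<in> S \<Longrightarrow> christoffel G k j i x = christoffel G k i j x"
  by (rule lower_inject[where x=x]) (simp_all add: lower_christoffel christoffel1_commute)

text \<open>This is \<nabla>g = 0 in coordinates: the other derivatives in the two symbols cancel by
  symmetry of the metric.\<close>

lemma metric_compatible:
  assumes "x \<in> S"
  shows "pderivative i (\<lambda>y. G y $ k $ a) x = christoffel1 G k i a x + christoffel1 G a i k x"
  using pderivative_sym[OF assms, of i k a] pderivative_sym[OF assms, of a i k]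
    pderivative_sym[OF assms, of k i a]
  by (simp add: christoffel1_def field_simps)

lemma differentiable_christoffel1:
  assumes "x \<in> S"
  shows "christoffel1 G k i j differentiable (at x)"
  unfolding christoffel1_def[abs_def]
  using assms by (intro differentiable_mult differentiable_diff differentiable_add diff' differentiable_const)

lemma differentiable_christoffel:
  assumes "x \<in> S"
  shows "christoffel G k i j differentiable (at x)"
proof -
  have "christoffel G k i j = (\<lambda>x. \<Sum>l\<in>UNIV. matrix_inv (G x) $ k $ l * christoffel1 G l i j x)"
    by (simp add: fun_eq_iff christoffel_def christoffel1_def sum_distrib_left mult.left_commute)
  then show ?thesis
    using assms by (auto intro!: differentiable_mult differentiable_sum differentiable_christoffel1
        differentiable_matrix_inv[OF open_S] inv diff)
qed

text \<open>The Leibniz rule for the lowered symbol, with the derivative of the metric replaced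
  through \<open>metric_compatible\<close>.\<close>

lemma lower_pderivative_christoffel:
  assumes x: "x \<in> S"
  shows "(\<Sum>a\<in>UNIV. G x $ k $ a * pderivative i (christoffel G a j l) x) =
    pderivative i (christoffel1 G k j l) x
      - (\<Sum>a\<in>UNIV. (christoffel1 G k i a x + christoffel1 G a i k x) * christoffel G a j l x)"
proof -
  have "pderivative i (christoffel1 G k j l) x =
      pderivative i (\<lambda>y. \<Sum>a\<in>UNIV. G y $ k $ a * christoffel G a j l y) x"
    using open_S x by (rule pderivative_cong_open) (simp add: lower_christoffel)
  also have "\<dots> = (\<Sum>a\<in>UNIV. pderivative i (\<lambda>y. G y $ k $ a * christoffel G a j l y) x)"
    using x by (intro pderivative_sum differentiable_mult diff differentiable_christoffel)
  also have "\<dots> = (\<Sum>a\<in>UNIV. G x $ k $ a * pderivative i (christoffel G a j l) x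
      + (christoffel1 G k i a x + christoffel1 G a i k x) * christoffel G a j l x)"
    using x by (simp add: pderivative_mult diff differentiable_christoffel metric_compatible)
  finally show ?thesis
    by (simp add: sum.distrib)
qed

text \<open>The inner product of \<open>\<nabla>\<^sub>i\<partial>\<^sub>k\<close> and
  \<open>\<nabla>\<^sub>j\<partial>\<^sub>l\<close>, which accounts for the symmetries proved
  next.\<close>

definition chris_prod :: "'n \<Rightarrow> 'n \<Rightarrow> 'n \<Rightarrow> 'n \<Rightarrow> real ^ 'n \<Rightarrow> real"
  where "chris_prod i k j l x = (\<Sum>a\<in>UNIV. christoffel1 G a i k x * christoffel G a j l x)"

lemma chris_prod_commute:
  assumes "x \<in> S"
  shows "chris_prod j l i k x = chris_prod i k j l x"
proof -
  have "chris_prod i k j l x =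
      (\<Sum>a\<in>UNIV. \<Sum>b\<in>UNIV. G x $ a $ b * christoffel G b i k x * christoffel G a j l x)"
    using assms by (simp add: chris_prod_def sum_distrib_right flip: lower_christoffel)
  also have "\<dots> = (\<Sum>b\<in>UNIV. \<Sum>a\<in>UNIV. G x $ a $ b * christoffel G b i k x * christoffel G a j l x)"
    by (rule sum.swap)
  also have "\<dots> = (\<Sum>b\<in>UNIV. \<Sum>a\<in>UNIV. G x $ b $ a * christoffel G a j l x * christoffel G b i k x)"
    using sym[OF assms] by (simp add: mult_ac)
  also have "\<dots> = chris_prod j l i k x"
    using assms by (simp add: chris_prod_def sum_distrib_right flip: lower_christoffel)
  finally show ?thesis ..
qed

lemma chris_prod_swap:
  "x \<in> S \<Longrightarrow> chris_prod k i j l x = chris_prod i k j l x"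
  "x \<in> S \<Longrightarrow> chris_prod i k l j x = chris_prod i k j l x"
  by (simp_all add: chris_prod_def christoffel1_commute[of x _ k i] christoffel_commute[of x _ j l])

text \<open>Lowering the differentiated symbols leaves two quadratic corrections for each; one of
  them cancels the quadratic part of \<open>riemann_op\<close>, and the other is a
  \<open>chris_prod\<close>.\<close>

lemma lowered_curvature_eq:
  assumes x: "x \<in> S"
  shows "lowered_curvature G i j k l x =
    pderivative i (christoffel1 G k j l) x - pderivative j (christoffel1 G k i l) x
      - chris_prod i k j l x + chris_prod j k i l x"
proof -
  have quad: "(\<Sum>a\<in>UNIV. G x $ k $ a * (\<Sum>b\<in>UNIV. christoffel G a i b x * c b)) =
      (\<Sum>b\<in>UNIV. christoffel1 G k i b x * c b)" for i c
  proof -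
    have "(\<Sum>a\<in>UNIV. G x $ k $ a * (\<Sum>b\<in>UNIV. christoffel G a i b x * c b)) =
        (\<Sum>a\<in>UNIV. \<Sum>b\<in>UNIV. G x $ k $ a * christoffel G a i b x * c b)"
      by (simp add: sum_distrib_left mult_ac)
    also have "\<dots> = (\<Sum>b\<in>UNIV. \<Sum>a\<in>UNIV. G x $ k $ a * christoffel G a i b x * c b)"
      by (rule sum.swap)
    finally show ?thesis
      using x by (simp add: lower_christoffel flip: sum_distrib_right)
  qed
  have "lowered_curvature G i j k l x =
      (\<Sum>a\<in>UNIV. G x $ k $ a * pderivative i (christoffel G a j l) x)
      - (\<Sum>a\<in>UNIV. G x $ k $ a * pderivative j (christoffel G a i l) x)
      + (\<Sum>a\<in>UNIV. G x $ k $ a * (\<Sum>b\<in>UNIV. christoffel G a i b x * christoffel G b j l x))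
      - (\<Sum>a\<in>UNIV. G x $ k $ a * (\<Sum>b\<in>UNIV. christoffel G a j b x * christoffel G b i l x))"
    by (simp add: lowered_curvature_def riemann_op_def sum.distrib sum_subtractf algebra_simps)
  then show ?thesis
    unfolding quad lower_pderivative_christoffel[OF x]
    by (simp add: chris_prod_def sum.distrib algebra_simps)
qed

lemma pderivative_christoffel1:
  assumes "x \<in> S"
  shows "pderivative i (christoffel1 G k j l) x = 1 / 2 *
    (pderivative i (pderivative j (\<lambda>y. G y $ l $ k)) x + pderivative i (pderivative l (\<lambda>y. G y $ j $ k)) x
      - pderivative i (pderivative k (\<lambda>y. G y $ j $ l)) x)"
  unfolding christoffel1_def[abs_def]
  using assms by (simp only: pderivative_const_mult pderivative_diff pderivative_add diff'
      differentiable_add differentiable_diff)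

lemma lowered_curvature_skew1: "lowered_curvature G j i k l x = - lowered_curvature G i j k l x"
  by (simp add: lowered_curvature_def riemann_op_def sum_subtractf algebra_simps flip: sum_negf)

end

section \<open>Symmetries of the curvature tensor\<close>

locale coord_metric_C2 = coord_metric +
  assumes C2: "\<And>i j. Ck_on 2 S (\<lambda>y. G y $ i $ j)"
begin

lemma second_pderivative_commute:
  "x \<in> S \<Longrightarrow> pderivative b (pderivative a (\<lambda>y. G y $ i $ j)) x = pderivative a (pderivative b (\<lambda>y. G y $ i $ j)) x"
  using open_S C2 by (metis pderivative_commute)

lemma second_pderivative_sym:
  "x \<in> S \<Longrightarrow> pderivative a (pderivative b (\<lambda>y. G y $ j $ i)) x = pderivative a (pderivative b (\<lambda>y. G y $ i $ j)) x"
  using open_S by (rule pderivative_cong_open) (auto simp: pderivative_sym)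

text \<open>Of the six second derivatives of the metric, the two taken in directions
  \<open>i\<close> and \<open>j\<close> cancel by commutation.\<close>

lemma lowered_curvature_explicit:
  assumes x: "x \<in> S"
  shows "lowered_curvature G i j k l x = 1 / 2 *
     (pderivative i (pderivative l (\<lambda>y. G y $ j $ k)) x - pderivative i (pderivative k (\<lambda>y. G y $ j $ l)) x
    - pderivative j (pderivative l (\<lambda>y. G y $ i $ k)) x + pderivative j (pderivative k (\<lambda>y. G y $ i $ l)) x)
    - chris_prod i k j l x + chris_prod j k i l x"
  using x by (simp add: lowered_curvature_eq pderivative_christoffel1 
      second_pderivative_commute[OF x, of i j] field_simps)

text \<open>Exchanging \<open>k\<close> and \<open>l\<close> negates the second-derivative part
  directly; \<open>chris_prod_commute\<close> does the same for the quadratic part.\<close>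

lemma lowered_curvature_skew2:
  assumes x: "x \<in> S"
  shows "lowered_curvature G i j l k x = - lowered_curvature G i j k l x"
  unfolding lowered_curvature_explicit[OF x]
  using chris_prod_commute[OF x, of i l j k] chris_prod_commute[OF x, of i k j l] by argo

text \<open>The exchange of pairs permutes the four second derivatives, up to order of
  differentiation and symmetry of the metric, and fixes both quadratic terms up to the symmetries of
  \<open>chris_prod\<close>.\<close>

lemma lowered_curvature_pair:
  assumes x: "x \<in> S"
  shows "lowered_curvature G k l i j x = lowered_curvature G i j k l x"
  unfolding lowered_curvature_explicit[OF x]
  using second_pderivative_commute[OF x, of l i k j] second_pderivative_sym[OF x, of i l k j]
    second_pderivative_commute[OF x, of k i l j] second_pderivative_sym[OF x, of i k l j]
    second_pderivative_commute[OF x, of l j k i] second_pderivative_sym[OF x, of j l k i]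
    second_pderivative_commute[OF x, of k j l i] second_pderivative_sym[OF x, of j k l i]
    chris_prod_swap(1)[OF x, of i k l j] chris_prod_swap(2)[OF x, of i k l j]
    chris_prod_swap(1)[OF x, of i l k j] chris_prod_swap(2)[OF x, of i l k j]
    chris_prod_commute[OF x, of j k i l]
  by argo

end

section \<open>Conformal change of the metric\<close>

locale conformal_change = coord_metric S G
  for S :: "(real ^ 'n::finite) set" and G :: "real ^ 'n \<Rightarrow> real ^ 'n ^ 'n" +
  fixes \<phi> :: "real ^ 'n \<Rightarrow> real"
  assumes \<phi>_diff: "\<And>x. x \<in> S \<Longrightarrow> \<phi> differentiable (at x)"
    and \<phi>_diff': "\<And>x i. x \<in> S \<Longrightarrow> pderivative i \<phi> differentiable (at x)"
begin

definition scaled :: "real ^ 'n \<Rightarrow> real ^ 'n ^ 'n"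
  where "scaled = (\<lambda>x. exp (2 * \<phi> x) *\<^sub>R G x)"

lemma scaled_component: "scaled x $ i $ j = exp (2 * \<phi> x) * G x $ i $ j"
  by (simp add: scaled_def)

lemma factor_differentiable: "x \<in> S \<Longrightarrow> (\<lambda>y. exp (2 * \<phi> y)) differentiable (at x)"
  by (intro differentiable_exp differentiable_mult differentiable_const \<phi>_diff)

lemma pderivative_factor:
  "x \<in> S \<Longrightarrow> pderivative k (\<lambda>y. exp (2 * \<phi> y)) x = exp (2 * \<phi> x) * (2 * pderivative k \<phi> x)"
  by (simp add: pderivative_exp pderivative_const_mult \<phi>_diff differentiable_mult)

lemma pderivative_scaled:
  assumes "x \<in> S"
  shows "pderivative k (\<lambda>y. scaled y $ i $ j) x =
    exp (2 * \<phi> x) * (2 * pderivative k \<phi> x * G x $ i $ j + pderivative k (\<lambda>y. G y $ i $ j) x)"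
  using assms
  by (simp only: scaled_component pderivative_mult factor_differentiable diff pderivative_factor)
    (simp add: algebra_simps)

sublocale scaled: coord_metric S scaled
proof
  show "open S" by (rule open_S)
  show "(\<lambda>y. scaled y $ i $ j) differentiable (at x)" if "x \<in> S" for x i j
    unfolding scaled_component using that by (intro differentiable_mult factor_differentiable diff)
  show "pderivative k (\<lambda>y. scaled y $ i $ j) differentiable (at x)" if x: "x \<in> S" for x i j k
  \<comment> \<open>The first derivative is replaced on \<open>S\<close> by its product-rule
    expression, whose factors are known to be differentiable.\<close>
  proof (rule differentiable_cong_open[OF _ open_S x pderivative_scaled[symmetric]])
    show "(\<lambda>x. exp (2 * \<phi> x) * (2 * pderivative k \<phi> x * G x $ i $ j + pderivative k (\<lambda>y. G y $ i $ j) x))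
        differentiable (at x)"
      using x by (intro differentiable_mult differentiable_add differentiable_const factor_differentiable
          \<phi>_diff' diff diff')
  qed
  show "scaled x $ j $ i = scaled x $ i $ j" if "x \<in> S" for x i j
    using that by (simp add: scaled_component sym[of x i j])
  show "invertible (scaled x)" if "x \<in> S" for x
    unfolding scaled_def using inv[OF that] by (simp add: scalar_invertible)
qed

section \<open>Christoffel symbols of the scaled metric\<close>

definition grad :: "'n \<Rightarrow> real ^ 'n \<Rightarrow> real"
  where "grad k x = (\<Sum>l\<in>UNIV. matrix_inv (G x) $ k $ l * pderivative l \<phi> x)"

lemma lower_grad: "x \<in> S \<Longrightarrow> (\<Sum>k\<in>UNIV. G x $ l $ k * grad k x) = pderivative l \<phi> x"
  by (simp add: grad_def lower_raise)

lemma christoffel1_scaled: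
  assumes "x \<in> S"
  shows "christoffel1 scaled k i j x = exp (2 * \<phi> x) * (christoffel1 G k i j x
    + pderivative i \<phi> x * G x $ k $ j + pderivative j \<phi> x * G x $ k $ i - pderivative k \<phi> x * G x $ i $ j)"
  using sym[OF assms, of j k] sym[OF assms, of i k]
  by (simp add: christoffel1_def pderivative_scaled[OF assms] algebra_simps)

text \<open>Both sides are lowered with the scaled metric: the Kronecker deltas select metric
  entries, the gradient lowers to the differential of \<open>\<phi>\<close>, and
  \<open>christoffel1_scaled\<close> results.\<close>

lemma christoffel_scaled:
  assumes x: "x \<in> S"
  shows "christoffel scaled k i j x = christoffel G k i j x
    + pderivative i \<phi> x * (if k = j then 1 else 0) + pderivative j \<phi> x * (if k = i then 1 else 0)
    - grad k x * G x $ i $ j"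
proof (rule scaled.lower_inject[OF x, where c = "\<lambda>k. christoffel scaled k i j x" and k = k and
      d = "\<lambda>k. christoffel G k i j x
    + pderivative i \<phi> x * (if k = j then 1 else 0) + pderivative j \<phi> x * (if k = i then 1 else 0)
    - grad k x * G x $ i $ j"])
  fix l
  have "(\<Sum>k\<in>UNIV. scaled x $ l $ k * (christoffel G k i j x
      + pderivative i \<phi> x * (if k = j then 1 else 0) + pderivative j \<phi> x * (if k = i then 1 else 0)
      - grad k x * G x $ i $ j)) =
    exp (2 * \<phi> x) * ((\<Sum>k\<in>UNIV. G x $ l $ k * christoffel G k i j x)
      + pderivative i \<phi> x * (\<Sum>k\<in>UNIV. if k = j then G x $ l $ k else 0)
      + pderivative j \<phi> x * (\<Sum>k\<in>UNIV. if k = i then G x $ l $ k else 0)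
      - (\<Sum>k\<in>UNIV. G x $ l $ k * grad k x) * G x $ i $ j)"
    by (simp add: scaled_component sum.distrib sum_subtractf sum_distrib_left sum_distrib_right algebra_simps
        if_distrib[where f = "\<lambda>z. z * _"] if_distrib[where f = "\<lambda>z. _ * z"] cong: if_cong)
  then show "(\<Sum>k\<in>UNIV. scaled x $ l $ k * christoffel scaled k i j x) =
    (\<Sum>k\<in>UNIV. scaled x $ l $ k * (christoffel G k i j x
      + pderivative i \<phi> x * (if k = j then 1 else 0) + pderivative j \<phi> x * (if k = i then 1 else 0)
      - grad k x * G x $ i $ j))"
    by (simp add: scaled.lower_christoffel[OF x] christoffel1_scaled[OF x] lower_christoffel[OF x] lower_grad[OF x])
qed

lemma pderivative_christoffel1_scaled:
  assumes x: "x \<in> S"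
  shows "pderivative i (christoffel1 scaled k j l) x = exp (2 * \<phi> x) * (
      2 * pderivative i \<phi> x * (christoffel1 G k j l x + pderivative j \<phi> x * G x $ k $ l
        + pderivative l \<phi> x * G x $ k $ j - pderivative k \<phi> x * G x $ j $ l)
      + pderivative i (christoffel1 G k j l) x
      + pderivative i (pderivative j \<phi>) x * G x $ k $ l + pderivative j \<phi> x * pderivative i (\<lambda>y. G y $ k $ l) x
      + pderivative i (pderivative l \<phi>) x * G x $ k $ j + pderivative l \<phi> x * pderivative i (\<lambda>y. G y $ k $ j) x
      - pderivative i (pderivative k \<phi>) x * G x $ j $ l - pderivative k \<phi> x * pderivative i (\<lambda>y. G y $ j $ l) x)"
proof -
  have "pderivative i (christoffel1 scaled k j l) x = pderivative i (\<lambda>x. exp (2 * \<phi> x) * (christoffel1 G k j l x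
    + pderivative j \<phi> x * G x $ k $ l + pderivative l \<phi> x * G x $ k $ j - pderivative k \<phi> x * G x $ j $ l)) x"
    using open_S x by (rule pderivative_cong_open) (rule christoffel1_scaled)
  then show ?thesis
    using x by (simp only: pderivative_mult pderivative_add pderivative_diff pderivative_factor
      factor_differentiable diff \<phi>_diff' differentiable_christoffel1
      differentiable_add differentiable_diff differentiable_mult) (simp add: algebra_simps)
qed

section \<open>Curvature of the scaled metric\<close>

definition hess :: "'n \<Rightarrow> 'n \<Rightarrow> real ^ 'n \<Rightarrow> real"
  where "hess i j x = pderivative i (pderivative j \<phi>) x
    - (\<Sum>a\<in>UNIV. christoffel G a i j x * pderivative a \<phi> x)"

definition grad_norm2 :: "real ^ 'n \<Rightarrow> real"
  where "grad_norm2 x = (\<Sum>a\<in>UNIV. pderivative a \<phi> x * grad a x)"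

text \<open>Minus the change of the Schouten tensor.\<close>

definition schouten_change :: "'n \<Rightarrow> 'n \<Rightarrow> real ^ 'n \<Rightarrow> real"
  where "schouten_change i j x = hess i j x - pderivative i \<phi> x * pderivative j \<phi> x
    + grad_norm2 x / 2 * G x $ i $ j"

text \<open>The scaled symbols of both kinds have four summands each; every contraction between them
  is again a symbol, a derivative of \<open>\<phi>\<close>, a metric entry or the squared gradient
  norm.\<close>

lemma chris_prod_scaled:
  assumes x: "x \<in> S"
  defines "d \<equiv> \<lambda>i. pderivative i \<phi> x" and "c \<equiv> \<lambda>k i j. christoffel1 G k i j x"
    and "N \<equiv> \<lambda>i j. \<Sum>a\<in>UNIV. christoffel G a i j x * pderivative a \<phi> x"
  shows "scaled.chris_prod i k j l x = exp (2 * \<phi> x) * (chris_prod i k j l x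
      + d j * c l i k + d l * c j i k - N i k * G x $ j $ l
      + d i * (c k j l + d j * G x $ k $ l + d l * G x $ k $ j - d k * G x $ j $ l)
      + d k * (c i j l + d j * G x $ i $ l + d l * G x $ i $ j - d i * G x $ j $ l)
      - G x $ i $ k * (N j l + 2 * d j * d l - grad_norm2 x * G x $ j $ l))"
proof -
  \<comment> \<open>The contracted index is moved from the symbol to the gradient, so that both
    sides contract the symbol of the second kind with the differential of
    \<open>\<phi>\<close>.\<close>
  have e1: "(\<Sum>a\<in>UNIV. c a i k * grad a x) = N i k"
  proof -
    have "(\<Sum>a\<in>UNIV. c a i k * grad a x) =
        (\<Sum>a\<in>UNIV. \<Sum>b\<in>UNIV. G x $ b $ a * grad a x * christoffel G b i k x)"
      using x sym[OF x] by (simp add: c_def sum_distrib_left sum_distrib_right mult_ac flip: lower_christoffel)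
    also have "\<dots> = (\<Sum>b\<in>UNIV. \<Sum>a\<in>UNIV. G x $ b $ a * grad a x * christoffel G b i k x)"
      by (rule sum.swap)
    also have "\<dots> = N i k"
      unfolding N_def sum_distrib_right[symmetric] lower_grad[OF x] by (simp only: mult.commute)
    finally show ?thesis .
  qed
  have e2: "(\<Sum>a\<in>UNIV. G x $ k $ a * christoffel G a j l x) = c k j l" for k
    using x by (simp add: c_def lower_christoffel)
  have e3: "(\<Sum>a\<in>UNIV. G x $ k $ a * grad a x) = d k" for k
    using x by (simp add: d_def lower_grad)
  have e4: "(\<Sum>a\<in>UNIV. d a * christoffel G a j l x) = N j l"
    by (simp add: N_def d_def mult.commute)
  have e5: "(\<Sum>a\<in>UNIV. d a * grad a x) = grad_norm2 x"
    by (simp add: grad_norm2_def d_def)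
  have e6: "(\<Sum>a\<in>UNIV. f a * (if a = j then 1 else 0)) = f j" for f :: "'n \<Rightarrow> real" and j
  proof -
    have "(\<Sum>a\<in>UNIV. f a * (if a = j then 1 else 0)) = (\<Sum>a\<in>UNIV. if a = j then f a else 0)"
      by (rule sum.cong) auto
    then show ?thesis by simp
  qed
  \<comment> \<open>One linear rule for contracting \<open>f\<close> with the scaled symbol, applied
    to each of the four summands of the other factor.\<close>
  have expand: "(\<Sum>a\<in>UNIV. f a * (christoffel G a j l x + d j * (if a = l then 1 else 0)
        + d l * (if a = j then 1 else 0) - grad a x * G x $ j $ l)) =
      (\<Sum>a\<in>UNIV. f a * christoffel G a j l x) + d j * f l + d l * f j
      - (\<Sum>a\<in>UNIV. f a * grad a x) * G x $ j $ l" for f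
  proof -
    have "(\<Sum>a\<in>UNIV. f a * (christoffel G a j l x + d j * (if a = l then 1 else 0)
        + d l * (if a = j then 1 else 0) - grad a x * G x $ j $ l)) =
      (\<Sum>a\<in>UNIV. f a * christoffel G a j l x) + d j * (\<Sum>a\<in>UNIV. f a * (if a = l then 1 else 0))
        + d l * (\<Sum>a\<in>UNIV. f a * (if a = j then 1 else 0)) - (\<Sum>a\<in>UNIV. f a * grad a x) * G x $ j $ l"
      unfolding sum_distrib_left sum_distrib_right sum.distrib[symmetric] sum_subtractf[symmetric]
      by (rule sum.cong) (simp_all add: algebra_simps)
    then show ?thesis by (simp only: e6)
  qed
  have "scaled.chris_prod i k j l x = exp (2 * \<phi> x) *
      (\<Sum>a\<in>UNIV. (c a i k + d i * G x $ k $ a + d k * G x $ i $ a - G x $ i $ k * d a) *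
        (christoffel G a j l x + d j * (if a = l then 1 else 0)
        + d l * (if a = j then 1 else 0) - grad a x * G x $ j $ l))"
    unfolding scaled.chris_prod_def sum_distrib_left christoffel1_scaled[OF x] christoffel_scaled[OF x]
    using sym[OF x]
    by (intro sum.cong refl) (simp add: c_def d_def mult.assoc mult.commute[of _ "G x $ i $ k"])
  also have "(\<Sum>a\<in>UNIV. (c a i k + d i * G x $ k $ a + d k * G x $ i $ a - G x $ i $ k * d a) * (christoffel G a j l x + d j * (if a = l then 1 else 0)
        + d l * (if a = j then 1 else 0) - grad a x * G x $ j $ l)) =
      (\<Sum>a\<in>UNIV. c a i k * (christoffel G a j l x + d j * (if a = l then 1 else 0)
        + d l * (if a = j then 1 else 0) - grad a x * G x $ j $ l))
      + d i * (\<Sum>a\<in>UNIV. G x $ k $ a * (christoffel G a j l x + d j * (if a = l then 1 else 0)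
        + d l * (if a = j then 1 else 0) - grad a x * G x $ j $ l))
      + d k * (\<Sum>a\<in>UNIV. G x $ i $ a * (christoffel G a j l x + d j * (if a = l then 1 else 0)
        + d l * (if a = j then 1 else 0) - grad a x * G x $ j $ l))
      - G x $ i $ k * (\<Sum>a\<in>UNIV. d a * (christoffel G a j l x + d j * (if a = l then 1 else 0)
        + d l * (if a = j then 1 else 0) - grad a x * G x $ j $ l))"
    unfolding sum_distrib_left sum.distrib[symmetric] sum_subtractf[symmetric]
    by (rule sum.cong) (simp_all add: left_diff_distrib distrib_right mult.assoc)
  finally show ?thesis
    unfolding expand e1 e2 e3 e4 e5 by (simp add: chris_prod_def c_def algebra_simps)
qed

text \<open>The bracket subtracted on the right is the product of the double forms \<open>G\<close>
  and \<open>schouten_change\<close>. With derivatives of the metric expressed by Christoffel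
  symbols, the law is a polynomial identity modulo the symmetries of its ingredients.\<close>

lemma lowered_curvature_scaled:
  assumes x: "x \<in> S"
    and hess_sym: "\<And>i j. pderivative j (pderivative i \<phi>) x = pderivative i (pderivative j \<phi>) x"
  shows "lowered_curvature scaled i j k l x = exp (2 * \<phi> x) * (lowered_curvature G i j k l x
    - (G x $ i $ k * schouten_change j l x + G x $ j $ l * schouten_change i k x
      - G x $ i $ l * schouten_change j k x - G x $ j $ k * schouten_change i l x))"
  unfolding scaled.lowered_curvature_eq[OF x] lowered_curvature_eq[OF x]
    pderivative_christoffel1_scaled[OF x] chris_prod_scaled[OF x] schouten_change_def hess_def
    metric_compatible[OF x]
  using sym[OF x] hess_sym christoffel1_commute[OF x]
  by (simp add: algebra_simps)

end

section \<open>Quadrilinear forms and orthonormal frames\<close>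

definition form4 :: "('n \<Rightarrow> 'n \<Rightarrow> 'n \<Rightarrow> 'n \<Rightarrow> real) \<Rightarrow>
    real ^ 'n \<Rightarrow> real ^ 'n \<Rightarrow> real ^ 'n \<Rightarrow> real ^ 'n::finite \<Rightarrow> real"
  where "form4 L x y z w = (\<Sum>i\<in>UNIV. \<Sum>j\<in>UNIV. \<Sum>k\<in>UNIV. \<Sum>l\<in>UNIV.
    x $ i * y $ j * z $ k * w $ l * L i j k l)"

lemma form4_swap1: "form4 (\<lambda>i j k l. L j i k l) x y z w = form4 L y x z w"
proof -
  have "form4 L y x z w = (\<Sum>i\<in>UNIV. \<Sum>j\<in>UNIV. \<Sum>k\<in>UNIV. \<Sum>l\<in>UNIV.
      y $ j * x $ i * z $ k * w $ l * L j i k l)"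
    unfolding form4_def by (rule sum.swap)
  then show ?thesis by (simp add: form4_def mult_ac)
qed

lemma form4_swap2: "form4 (\<lambda>i j k l. L i j l k) x y z w = form4 L x y w z"
proof -
  have "(\<Sum>k\<in>UNIV. \<Sum>l\<in>UNIV. x $ i * y $ j * w $ k * z $ l * L i j k l) =
      (\<Sum>k\<in>UNIV. \<Sum>l\<in>UNIV. x $ i * y $ j * w $ l * z $ k * L i j l k)" for i j
    by (rule sum.swap)
  then show ?thesis by (simp add: form4_def mult_ac)
qed

lemma form4_swap_middle: "form4 L x y z w = (\<Sum>i\<in>UNIV. \<Sum>k\<in>UNIV. \<Sum>j\<in>UNIV. \<Sum>l\<in>UNIV.
    x $ i * y $ j * z $ k * w $ l * L i j k l)"
  unfolding form4_def by (rule sum.cong[OF refl], rule sum.swap)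

lemma form4_swap_pair: "form4 (\<lambda>i j k l. L k l i j) x y z w = form4 L z w x y"
proof -
  have "form4 L z w x y = (\<Sum>k\<in>UNIV. \<Sum>i\<in>UNIV. \<Sum>l\<in>UNIV. \<Sum>j\<in>UNIV.
      z $ k * w $ l * x $ i * y $ j * L k l i j)"
    by (rule form4_swap_middle)
  also have "\<dots> = (\<Sum>i\<in>UNIV. \<Sum>k\<in>UNIV. \<Sum>l\<in>UNIV. \<Sum>j\<in>UNIV.
      z $ k * w $ l * x $ i * y $ j * L k l i j)"
    by (rule sum.swap)
  also have "\<dots> = (\<Sum>i\<in>UNIV. \<Sum>k\<in>UNIV. \<Sum>j\<in>UNIV. \<Sum>l\<in>UNIV.
      z $ k * w $ l * x $ i * y $ j * L k l i j)"
    by (rule sum.cong[OF refl], rule sum.cong[OF refl], rule sum.swap)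
  finally show ?thesis
    by (simp add: form4_swap_middle mult_ac)
qed

text \<open>Each term of a product of two bilinear forms has this shape up to a permutation of
  arguments.\<close>

lemma form4_product:
  fixes A B :: "real ^ 'n ^ 'n"
  shows "form4 (\<lambda>i j k l. A $ i $ k * B $ j $ l) x y z w = ip A x z * ip B y w"
proof -
  have ip: "ip A x z = (\<Sum>i\<in>UNIV. \<Sum>k\<in>UNIV. x $ i * A $ i $ k * z $ k)"
    for A :: "real ^ 'n ^ 'n" and x z
    by (simp add: ip_def inner_vec_def matrix_vector_mult_def sum_distrib_left mult.assoc)
  have "ip A x z * ip B y w = (\<Sum>i\<in>UNIV. \<Sum>k\<in>UNIV. \<Sum>j\<in>UNIV. \<Sum>l\<in>UNIV.
      x $ i * A $ i $ k * z $ k * (y $ j * B $ j $ l * w $ l))"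
    unfolding ip sum_distrib_right by (simp only: sum_distrib_left)
  then show ?thesis
    by (simp add: form4_swap_middle mult_ac)
qed

lemma form4_add: "form4 (\<lambda>i j k l. L i j k l + M i j k l) x y z w = form4 L x y z w + form4 M x y z w"
  by (simp add: form4_def sum.distrib distrib_left)

lemma form4_diff: "form4 (\<lambda>i j k l. L i j k l - M i j k l) x y z w = form4 L x y z w - form4 M x y z w"
  by (simp add: form4_def sum_subtractf right_diff_distrib)

lemma form4_minus: "form4 (\<lambda>i j k l. - L i j k l) x y z w = - form4 L x y z w"
  by (simp add: form4_def sum_negf)

lemma form4_axis:
  fixes L :: "'n::finite \<Rightarrow> 'n \<Rightarrow> 'n \<Rightarrow> 'n \<Rightarrow> real"
  shows "form4 L (axis i 1) (axis j 1) (axis k 1) (axis l 1) = L i j k l"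
proof -
  have "axis i (1::real) $ a = (if a = i then 1 else 0)" for i a :: 'n
    by (simp add: axis_def)
  then show ?thesis
    by (simp add: form4_def if_distrib[where f = "\<lambda>z. z * _"] if_distrib[where f = "\<lambda>z. _ * z"] cong: if_cong)
qed

lemma linear_form4:
  "linear (\<lambda>x. form4 L x y z w)" "linear (\<lambda>y. form4 L x y z w)"
  "linear (\<lambda>z. form4 L x y z w)" "linear (\<lambda>w. form4 L x y z w)"
  by (rule linearI; simp add: form4_def sum.distrib sum_distrib_left algebra_simps)+

text \<open>Multilinearity is used one argument at a time; each stage frees one more argument from
  \<open>B\<close>.\<close>

lemma form4_eq_0_on_span:
  assumes span: "span B = UNIV"
    and zero: "\<And>x y z w. x \<in> B \<Longrightarrow> y \<in> B \<Longrightarrow> z \<in> B \<Longrightarrow> w \<in> B \<Longrightarrow> form4 L x y z w = 0"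
  shows "form4 L x y z w = 0"
proof -
  have "form4 L x y z w = 0" if "y \<in> B" "z \<in> B" "w \<in> B" for x y z w
    by (rule linear_eq_0_on_span[OF linear_form4(1), of B]) (use that span zero in auto)
  then have "form4 L x y z w = 0" if "z \<in> B" "w \<in> B" for x y z w
    by (rule linear_eq_0_on_span[OF linear_form4(2), of B]) (use that span in auto)
  then have "form4 L x y z w = 0" if "w \<in> B" for x y z w
    by (rule linear_eq_0_on_span[OF linear_form4(3), of B]) (use that span in auto)
  then show ?thesis
    by (rule linear_eq_0_on_span[OF linear_form4(4), of B]) (use span in auto)
qed

section \<open>Orthonormal frames\<close>

lemma ip_scaleR: "ip G (a *\<^sub>R x) y = a * ip G x y" "ip G x (a *\<^sub>R y) = a * ip G x y"
  by (simp_all add: ip_def matrix_scaleR_vector_ac flip: scaleR_matrix_vector_assoc)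

lemma ip_commute:
  assumes "transpose G = G"
  shows "ip G y x = ip G x y"
  using assms by (metis dot_lmul_matrix inner_commute ip_def vector_transpose_matrix)

text \<open>Gram--Schmidt, one vector at a time: a vector orthogonal to the images under \<open>G\<close> of the
  vectors found so far exists for dimension reasons.\<close>

lemma orthonormal_frame_exists:
  fixes G :: "real ^ 'n ^ 'n"
  assumes sym: "transpose G = G" and pos: "\<And>v. v \<noteq> 0 \<Longrightarrow> 0 < ip G v v"
  shows "\<exists>e. orthonormal_frame G e"
proof -
  have "\<exists>e. \<forall>i\<in>I. \<forall>j\<in>I. ip G (e i) (e j) = (if i = j then 1 else 0)" if "finite I" for I :: "'n set"
    using that
  proof (induction I rule: finite_induct)
    case (insert a I)
    then obtain e where e: "\<And>i j. i \<in> I \<Longrightarrow> j \<in> I \<Longrightarrow> ip G (e i) (e j) = (if i = j then 1 else 0)"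
      by blast
    have "dim ((\<lambda>i. G *v e i) ` I) \<le> card I"
      using insert.hyps(1) by (meson card_image_le dim_le_card' finite_imageI le_trans)
    also have "\<dots> < card (insert a I)"
      using insert.hyps by simp
    also have "\<dots> \<le> DIM(real ^ 'n)"
      by (simp add: card_mono)
    finally obtain v where v: "v \<noteq> 0" "\<And>y. y \<in> span ((\<lambda>i. G *v e i) ` I) \<Longrightarrow> orthogonal v y"
      using orthogonal_to_subspace_exists by blast
    have orth: "ip G v (e i) = 0" if "i \<in> I" for i
      using v(2)[OF span_base] that by (auto simp: ip_def orthogonal_def)
    define u where "u = (1 / sqrt (ip G v v)) *\<^sub>R v"
    have "ip G u u = 1"
      using pos[OF v(1)] by (simp add: u_def ip_scaleR)
    moreover have "ip G u (e i) = 0" "ip G (e i) u = 0" if "i \<in> I" for i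
      using orth[OF that] ip_commute[OF sym] by (simp_all add: u_def ip_scaleR)
    ultimately show ?case
      using e insert.hyps(2) by (intro exI[of _ "e(a := u)"]) auto
  qed simp
  from this[of UNIV] show ?thesis
    by (auto simp: orthonormal_frame_def)
qed

text \<open>If \<open>E\<close> has the frame as columns, orthonormality says that
  \<open>transpose E ** G\<close> is a left inverse of \<open>E\<close>. For square matrices it is
  also a right inverse, so every vector is a combination of the columns.\<close>

lemma span_orthonormal_frame:
  fixes G :: "real ^ 'n ^ 'n"
  assumes "orthonormal_frame G e"
  shows "span (range e) = UNIV"
proof -
  define E where "E = (\<chi> i a. e a $ i)"
  have "(transpose E ** G) ** E = mat 1"
  proof -
    have "(transpose E ** (G ** E)) $ a $ b = ip G (e a) (e b)" for a b
      by (simp add: E_def ip_def matrix_matrix_mult_def matrix_vector_mult_def inner_vec_def transpose_def)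
    then show ?thesis
      using assms by (simp add: matrix_mul_assoc[symmetric] vec_eq_iff mat_def orthonormal_frame_def)
  qed
  then have inv: "E ** (transpose E ** G) = mat 1"
    by (simp add: matrix_left_right_inverse)
  have "x \<in> span (range e)" for x
  proof -
    have "column a E = e a" for a
      by (simp add: E_def column_def vec_eq_iff)
    then have "E *v y \<in> span (range e)" for y
      by (simp add: matrix_mult_sum span_sum span_base span_scale scalar_mult_eq_scaleR)
    then have "E *v ((transpose E ** G) *v x) \<in> span (range e)" .
    then show ?thesis
      using inv by (simp add: matrix_vector_mul_assoc)
  qed
  then show ?thesis by auto
qed

section \<open>The two sign computations in frame components\<close>

lemma square_invariant_einstein:
  fixes r :: "'n::finite \<Rightarrow> 'n \<Rightarrow> 'n \<Rightarrow> 'n \<Rightarrow> real"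
  assumes pair: "\<And>a b c d. r c d a b = r a b c d"
    and ric: "\<And>b c. (\<Sum>a\<in>UNIV. r a b a c) = \<kappa> * (if b = c then 1 else 0)"
    and n: "CARD('n) \<ge> 4"
  shows "(\<Sum>b\<in>UNIV. \<Sum>a\<in>UNIV. r a b a b)\<^sup>2
      - 4 * (\<Sum>b\<in>UNIV. \<Sum>c\<in>UNIV. (\<Sum>a\<in>UNIV. r a b a c) * (\<Sum>a\<in>UNIV. r a c a b))
      + (\<Sum>a\<in>UNIV. \<Sum>b\<in>UNIV. \<Sum>c\<in>UNIV. \<Sum>d\<in>UNIV. r a b c d * r c d a b)
    \<ge> (\<Sum>a\<in>UNIV. \<Sum>b\<in>UNIV. \<Sum>c\<in>UNIV. \<Sum>d\<in>UNIV. (r a b c d)\<^sup>2)"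
proof -
  have delta: "(\<Sum>c\<in>UNIV. (\<kappa> * (if b = c then 1 else 0)) * (\<kappa> * (if c = b then 1 else 0))) = \<kappa>\<^sup>2" for b :: 'n
  proof -
    have "(\<Sum>c\<in>UNIV. (\<kappa> * (if b = c then 1 else 0)) * (\<kappa> * (if c = b then 1 else 0))) =
        (\<Sum>c\<in>UNIV. if b = c then \<kappa>\<^sup>2 else 0)"
      by (rule sum.cong) (auto simp: power2_eq_square)
    then show ?thesis by simp
  qed
  \<comment> \<open>The squared scalar curvature is \<open>\<kappa>\<^sup>2\<close> times the
    squared dimension, and four times the squared Ricci norm is \<open>\<kappa>\<^sup>2\<close>
    times four times the dimension; dimension at least 4 makes the first dominate.\<close>
  have "real CARD('n) * real CARD('n) \<ge> 4 * real CARD('n)"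
    using n by (intro mult_right_mono) auto
  then have "\<kappa>\<^sup>2 * (4 * real CARD('n)) \<le> \<kappa>\<^sup>2 * (real CARD('n) * real CARD('n))"
    by (rule mult_left_mono) simp
  moreover have "r a b c d * r c d a b = (r a b c d)\<^sup>2" for a b c d
    unfolding pair[of c d a b] by (simp add: power2_eq_square)
  ultimately show ?thesis
    unfolding ric delta by (simp add: power_mult_distrib power2_eq_square[of "real CARD('n)"] mult_ac)
qed

text \<open>Tracing \<open>r\<close> gives Ricci components (n - 2) h plus a multiple of the trace
  of h, and vanishing scalar curvature removes the trace. Each of the four terms of \<open>r\<close>
  then contributes (n - 2) |h|^2 to the full square, and 4 (n - 2)^2 - 4 (n - 2) = 4 (n - 2) (n -
  3).\<close>

lemma square_invariant_conformally_flat: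
  fixes h :: "'n::finite \<Rightarrow> 'n \<Rightarrow> real"
  assumes h: "\<And>a b. h b a = h a b"
    and r: "\<And>a b c d. r a b c d = (if a = c then 1 else 0) * h b d + (if b = d then 1 else 0) * h a c
      - (if a = d then 1 else 0) * h b c - (if b = c then 1 else 0) * h a d"
    and scal: "(\<Sum>b\<in>UNIV. \<Sum>a\<in>UNIV. r a b a b) = 0"
    and n: "CARD('n) \<ge> 2"
  shows "(\<Sum>b\<in>UNIV. \<Sum>c\<in>UNIV. (\<Sum>a\<in>UNIV. r a b a c) * (\<Sum>a\<in>UNIV. r a c a b)) * 4
      - (\<Sum>a\<in>UNIV. \<Sum>b\<in>UNIV. \<Sum>c\<in>UNIV. \<Sum>d\<in>UNIV. r a b c d * r c d a b) =
    4 * (real CARD('n) - 2) * (real CARD('n) - 3) * (\<Sum>b\<in>UNIV. \<Sum>c\<in>UNIV. (h b c)\<^sup>2)"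
proof -
  define n where "n = real CARD('n)"
  define t where "t = (\<Sum>a\<in>UNIV. h a a)"
  define H where "H = (\<Sum>b\<in>UNIV. \<Sum>c\<in>UNIV. (h b c)\<^sup>2)"
  have delta: "(\<Sum>a\<in>UNIV. (if a = b then 1 else 0) * f a) = f b"
    "(\<Sum>a\<in>UNIV. (if b = a then 1 else 0) * f a) = f b" for f :: "'n \<Rightarrow> real" and b
    by (simp_all add: if_distrib[where f = "\<lambda>z. z * _"] cong: if_cong)
  have ric: "(\<Sum>a\<in>UNIV. r a b a c) = (n - 2) * h b c + (if b = c then 1 else 0) * t" for b c
    unfolding r sum.distrib sum_subtractf delta sum_distrib_left[symmetric]
    by (simp add: n_def t_def delta h[of b c] algebra_simps)
  have "(\<Sum>b\<in>UNIV. \<Sum>a\<in>UNIV. r a b a b) = (n - 2) * t + n * t"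
    unfolding ric by (simp add: sum.distrib n_def t_def flip: sum_distrib_left)
  then have "(n - 1) * t = 0"
    using scal by (simp add: algebra_simps)
  \<comment> \<open>The scalar curvature is twice (n - 1) t, and n - 1 is nonzero.\<close>
  then have "t = 0"
    using assms(4) by (simp add: n_def)
  then have ric: "(\<Sum>a\<in>UNIV. r a b a c) = (n - 2) * h b c" for b c
    using ric by simp
  have skew: "r b a c d = - r a b c d" "r a b d c = - r a b c d" for a b c d
    using h[of a b] h[of c d] by (simp_all add: r)
  have pair: "r c d a b = r a b c d" for a b c d
    using h[of a b] h[of c d] h[of a d] h[of a c] h[of b c] h[of b d] by (simp add: r)
  define S where "S = (\<lambda>F :: 'n \<Rightarrow> 'n \<Rightarrow> 'n \<Rightarrow> 'n \<Rightarrow> real.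
    \<Sum>a\<in>UNIV. \<Sum>b\<in>UNIV. \<Sum>c\<in>UNIV. \<Sum>d\<in>UNIV. F a b c d)"
  have S_swap1: "S (\<lambda>a b c d. F b a c d) = S F" for F
    unfolding S_def by (rule sum.swap)
  have S_swap2: "S (\<lambda>a b c d. F a b d c) = S F" for F
    unfolding S_def by (rule sum.cong[OF refl], rule sum.cong[OF refl], rule sum.swap)
  have S_neg: "S (\<lambda>a b c d. - F a b c d) = - S F" for F
    by (simp add: S_def sum_negf)
  \<comment> \<open>The delta turns the contraction into a Ricci contraction with \<open>h\<close>.
    The other three delta terms reduce to this one by skew-symmetry and relabelling.\<close>
  have ac: "S (\<lambda>a b c d. (if a = c then 1 else 0) * (r a b c d * h b d)) = (n - 2) * H"
  proof -
    have "S (\<lambda>a b c d. (if a = c then 1 else 0) * (r a b c d * h b d)) =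
        (\<Sum>a\<in>UNIV. \<Sum>b\<in>UNIV. \<Sum>d\<in>UNIV. r a b a d * h b d)"
      unfolding S_def sum_distrib_left[symmetric] delta ..
    also have "\<dots> = (\<Sum>b\<in>UNIV. \<Sum>a\<in>UNIV. \<Sum>d\<in>UNIV. r a b a d * h b d)"
      by (rule sum.swap)
    also have "\<dots> = (\<Sum>b\<in>UNIV. \<Sum>d\<in>UNIV. \<Sum>a\<in>UNIV. r a b a d * h b d)"
      by (rule sum.cong[OF refl], rule sum.swap)
    also have "\<dots> = (n - 2) * H"
      unfolding sum_distrib_right[symmetric] ric H_def
      by (simp add: sum_distrib_left power2_eq_square mult.assoc)
    finally show ?thesis .
  qed
  have ad: "S (\<lambda>a b c d. (if a = d then 1 else 0) * (r a b c d * h b c)) = - ((n - 2) * H)"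
  proof -
    have "S (\<lambda>a b c d. (if a = d then 1 else 0) * (r a b c d * h b c)) =
        S (\<lambda>a b c d. - ((if a = d then 1 else 0) * (r a b d c * h b c)))"
      by (intro arg_cong[where f = S] ext) (subst skew(2), simp)
    also have "\<dots> = - S (\<lambda>a b c d. (if a = d then 1 else 0) * (r a b d c * h b c))"
      by (rule S_neg)
    also have "S (\<lambda>a b c d. (if a = d then 1 else 0) * (r a b d c * h b c)) =
        S (\<lambda>a b c d. (if a = c then 1 else 0) * (r a b c d * h b d))"
      by (rule S_swap2)
    finally show ?thesis
      unfolding ac by simp
  qed
  have bd: "S (\<lambda>a b c d. (if b = d then 1 else 0) * (r a b c d * h a c)) = (n - 2) * H"
  proof -
    have "S (\<lambda>a b c d. (if b = d then 1 else 0) * (r a b c d * h a c)) =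
        S (\<lambda>a b c d. - ((if b = d then 1 else 0) * (r b a c d * h a c)))"
      by (intro arg_cong[where f = S] ext) (subst skew(1), simp)
    also have "\<dots> = - S (\<lambda>a b c d. (if b = d then 1 else 0) * (r b a c d * h a c))"
      by (rule S_neg)
    also have "S (\<lambda>a b c d. (if b = d then 1 else 0) * (r b a c d * h a c)) =
        S (\<lambda>a b c d. (if a = d then 1 else 0) * (r a b c d * h b c))"
      by (rule S_swap1)
    finally show ?thesis
      unfolding ad by simp
  qed
  have bc: "S (\<lambda>a b c d. (if b = c then 1 else 0) * (r a b c d * h a d)) = - ((n - 2) * H)"
  proof -
    have "S (\<lambda>a b c d. (if b = c then 1 else 0) * (r a b c d * h a d)) =
        S (\<lambda>a b c d. - ((if b = c then 1 else 0) * (r b a c d * h a d)))"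
      by (intro arg_cong[where f = S] ext) (subst skew(1), simp)
    also have "\<dots> = - S (\<lambda>a b c d. (if b = c then 1 else 0) * (r b a c d * h a d))"
      by (rule S_neg)
    also have "S (\<lambda>a b c d. (if b = c then 1 else 0) * (r b a c d * h a d)) =
        S (\<lambda>a b c d. (if a = c then 1 else 0) * (r a b c d * h b d))"
      by (rule S_swap1)
    finally show ?thesis
      unfolding ac by simp
  qed
  have square: "(\<Sum>a\<in>UNIV. \<Sum>b\<in>UNIV. \<Sum>c\<in>UNIV. \<Sum>d\<in>UNIV. r a b c d * r c d a b) = 4 * (n - 2) * H"
  proof -
    have "r a b c d * r c d a b =
        (if a = c then 1 else 0) * (r a b c d * h b d) + (if b = d then 1 else 0) * (r a b c d * h a c)
        - (if a = d then 1 else 0) * (r a b c d * h b c) - (if b = c then 1 else 0) * (r a b c d * h a d)" for a b c d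
      unfolding pair[of c d a b]
      \<comment> \<open>Only one of the two equal factors is expanded; the other stays whole, to be
        contracted with the deltas.\<close>
      by (subst (2) r) (simp only: right_diff_distrib distrib_left mult.left_commute)
    then show ?thesis
      using ac ad bd bc by (simp add: S_def sum.distrib sum_subtractf)
  qed
  have "(\<Sum>b\<in>UNIV. \<Sum>c\<in>UNIV. (\<Sum>a\<in>UNIV. r a b a c) * (\<Sum>a\<in>UNIV. r a c a b)) = (n - 2)\<^sup>2 * H"
  proof -
    have "((n - 2) * h b c) * ((n - 2) * h c b) = (n - 2)\<^sup>2 * (h b c)\<^sup>2" for b c
      using h[of b c] by (simp add: power2_eq_square)
    then show ?thesis
      unfolding ric H_def by (simp add: sum_distrib_left)
  qed
  then show ?thesis
    unfolding square by (simp add: n_def H_def power2_eq_square algebra_simps)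
qed

section \<open>Algebraic curvature tensors\<close>

definition square_contraction :: "real ^ 'n ^ 'n \<Rightarrow> (real ^ 'n::finite) double_form \<Rightarrow> real"
  where "square_contraction G \<omega> = 1 / fact 4 * dval ((contract G ^^ 4) (double_form_mult \<omega> \<omega>)) [] []"

definition curvature_form ::
  "('n \<Rightarrow> 'n \<Rightarrow> 'n \<Rightarrow> 'n \<Rightarrow> real) \<Rightarrow> (real ^ 'n::finite) double_form"
  where "curvature_form L = DForm 2 2 (\<lambda>xs ys. form4 L (xs ! 0) (xs ! 1) (ys ! 0) (ys ! 1))"

text \<open>The pointwise data: the Gram matrix and the curvature components at one point, with the
  symmetries used in the sign arguments.\<close>

locale algebraic_curvature =
  fixes G :: "real ^ 'n ^ 'n" and L :: "'n::finite \<Rightarrow> 'n \<Rightarrow> 'n \<Rightarrow> 'n \<Rightarrow> real"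
  assumes sym: "transpose G = G"
    and pos: "\<And>v. v \<noteq> 0 \<Longrightarrow> 0 < ip G v v"
    and skew1: "\<And>i j k l. L j i k l = - L i j k l"
    and skew2: "\<And>i j k l. L i j l k = - L i j k l"
    and pair: "\<And>i j k l. L k l i j = L i j k l"
begin

text \<open>The same choice as in \<open>contract\<close>, so contractions unfold literally to sums
  over this frame.\<close>

definition frame :: "'n \<Rightarrow> real ^ 'n"
  where "frame = (SOME e. orthonormal_frame G e)"

definition r :: "'n \<Rightarrow> 'n \<Rightarrow> 'n \<Rightarrow> 'n \<Rightarrow> real"
  where "r a b c d = form4 L (frame a) (frame b) (frame c) (frame d)"

lemma orthonormal_frame: "orthonormal_frame G frame"
  unfolding frame_def using orthonormal_frame_exists[OF sym pos] by (rule someI_ex)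

lemma ip_frame: "ip G (frame a) (frame b) = (if a = b then 1 else 0)"
  using orthonormal_frame by (simp add: orthonormal_frame_def)

lemma square_contraction_frame:
  "square_contraction G (curvature_form L) =
    ((\<Sum>b\<in>UNIV. \<Sum>a\<in>UNIV. r a b a b)\<^sup>2
      - 4 * (\<Sum>b\<in>UNIV. \<Sum>c\<in>UNIV. (\<Sum>a\<in>UNIV. r a b a c) * (\<Sum>a\<in>UNIV. r a c a b))
      + (\<Sum>a\<in>UNIV. \<Sum>b\<in>UNIV. \<Sum>c\<in>UNIV. \<Sum>d\<in>UNIV. r a b c d * r c d a b)) / 4"
proof -
  have "(\<lambda>i j k l. L j i k l) = (\<lambda>i j k l. - L i j k l)" "(\<lambda>i j k l. L i j l k) = (\<lambda>i j k l. - L i j k l)"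
    by (intro ext, rule skew1, intro ext, rule skew2)
  then have swap: "form4 L y x z u = - form4 L x y z u" "form4 L x y u z = - form4 L x y z u" for x y z u
    using form4_swap1[of L x y z u] form4_swap2[of L x y z u] form4_minus[of L x y z u] by metis+
  have "alternating2 (\<lambda>xs ys. form4 L (xs ! 0) (xs ! 1) (ys ! 0) (ys ! 1))"
    by (simp add: alternating2_def) (intro allI conjI swap)
  from full_contraction_square[OF this, of G] show ?thesis
    by (simp add: square_contraction_def curvature_form_def r_def frame_def)
qed

lemma r_pair: "r c d a b = r a b c d"
proof -
  have "(\<lambda>i j k l. L k l i j) = L"
    by (intro ext) (rule pair)
  then show ?thesis
    using form4_swap_pair[of L "frame a" "frame b" "frame c" "frame d"] by (simp add: r_def)
qed

lemma ricci_frame: "(\<Sum>a\<in>UNIV. r a b a c) = dval (contract G (curvature_form L)) [frame b] [frame c]"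
  by (simp add: curvature_form_def r_def frame_def Let_def)

lemma scalar_frame:
  "(\<Sum>b\<in>UNIV. \<Sum>a\<in>UNIV. r a b a b) = dval ((contract G ^^ 2) (curvature_form L)) [] []"
  by (simp add: curvature_form_def contract_power_2 r_def frame_def Let_def)

lemma flat_if_frame:
  assumes "\<And>a b c d. r a b c d = 0"
  shows "form4 L x y z u = 0"
proof (rule form4_eq_0_on_span[OF span_orthonormal_frame[OF orthonormal_frame]])
  show "form4 L x y z u = 0"
    if "x \<in> range frame" "y \<in> range frame" "z \<in> range frame" "u \<in> range frame" for x y z u
    using that assms unfolding r_def by blast
qed

lemma square_contraction_flat:
  assumes "\<And>x y z u. form4 L x y z u = 0"
  shows "square_contraction G (curvature_form L) = 0"
  by (simp add: square_contraction_frame r_def assms)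

text \<open>Four times the invariant dominates the sum of squares of all frame components of the
  curvature; if it vanishes, so does each component.\<close>

lemma square_contraction_einstein:
  assumes einstein: "\<And>x y. dval (contract G (curvature_form L)) [x] [y] = \<kappa> * ip G x y"
    and n: "CARD('n) \<ge> 4"
  shows "square_contraction G (curvature_form L) \<ge> 0"
    and "square_contraction G (curvature_form L) = 0 \<Longrightarrow> form4 L x y z u = 0"
proof -
  define N where "N = (\<Sum>a\<in>UNIV. \<Sum>b\<in>UNIV. \<Sum>c\<in>UNIV. \<Sum>d\<in>UNIV. (r a b c d)\<^sup>2)"
  have "(\<Sum>a\<in>UNIV. r a b a c) = \<kappa> * (if b = c then 1 else 0)" for b c
    unfolding ricci_frame einstein ip_frame ..
  then have N: "N \<le> 4 * square_contraction G (curvature_form L)"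
    using square_invariant_einstein[of r \<kappa>, OF r_pair _ n]
    unfolding square_contraction_frame N_def by simp
  moreover have "N \<ge> 0"
    unfolding N_def by (intro sum_nonneg) auto
  ultimately show "square_contraction G (curvature_form L) \<ge> 0"
    by linarith
  assume "square_contraction G (curvature_form L) = 0"
  with N \<open>N \<ge> 0\<close> have "N = 0" by simp
  then have "r a b c d = 0" for a b c d
    unfolding N_def by (simp add: sum_nonneg_eq_0_iff sum_nonneg)
  then show "form4 L x y z u = 0"
    by (rule flat_if_frame)
qed

text \<open>In the frame the invariant is - (n - 2) (n - 3) |h|^2 with \<open>h\<close> the
  components of \<open>P\<close>. The coefficient is negative for n at least 4, and
  \<open>h = 0\<close> annihilates the curvature.\<close>

lemma square_contraction_kulkarni_nomizu:
  assumes P: "transpose P = P"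
    and L: "\<And>i j k l. L i j k l = G $ i $ k * P $ j $ l + G $ j $ l * P $ i $ k
      - G $ i $ l * P $ j $ k - G $ j $ k * P $ i $ l"
    and scal: "dval ((contract G ^^ 2) (curvature_form L)) [] [] = 0"
    and n: "CARD('n) \<ge> 4"
  shows "square_contraction G (curvature_form L) \<le> 0"
    and "square_contraction G (curvature_form L) = 0 \<Longrightarrow> form4 L x y z u = 0"
proof -
  define h where "h a b = ip P (frame a) (frame b)" for a b
  have h_sym: "h b a = h a b" for a b
    unfolding h_def by (rule ip_commute[OF P])
  define N where "N = (\<Sum>b\<in>UNIV. \<Sum>c\<in>UNIV. (h b c)\<^sup>2)"
  have "form4 L x y z u = ip G x z * ip P y u + ip P x z * ip G y u - ip G x u * ip P y z - ip P x u * ip G y z"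
    for x y z u
  proof -
    have "L = (\<lambda>i j k l. G $ i $ k * P $ j $ l + P $ i $ k * G $ j $ l
      - G $ i $ l * P $ j $ k - P $ i $ l * G $ j $ k)"
      by (simp add: fun_eq_iff L)
    then show ?thesis
      using form4_swap2[of "\<lambda>i j k l. G $ i $ k * P $ j $ l" x y z u]
        form4_swap2[of "\<lambda>i j k l. P $ i $ k * G $ j $ l" x y z u]
      by (simp add: form4_diff form4_add form4_product)
  qed
  then have r: "r a b c d = (if a = c then 1 else 0) * h b d + (if b = d then 1 else 0) * h a c
      - (if a = d then 1 else 0) * h b c - (if b = c then 1 else 0) * h a d" for a b c d
    by (simp add: r_def h_def ip_frame)
  have scal': "(\<Sum>b\<in>UNIV. \<Sum>a\<in>UNIV. r a b a b) = 0"
    using scal scalar_frame by simp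
  have arith: "(0\<^sup>2 - 4 * k + q) / 4 = - (a * b * x)" if "k * 4 - q = 4 * a * b * x" for k q a b x :: real
    using that by simp
  have "square_contraction G (curvature_form L) =
      - ((real CARD('n) - 2) * (real CARD('n) - 3) * N)"
    unfolding square_contraction_frame scal' N_def
    by (rule arith, rule square_invariant_conformally_flat[of h r, OF h_sym r scal']) (use n in simp)
  moreover have N: "N \<ge> 0"
    unfolding N_def by (intro sum_nonneg) auto
  moreover have c: "(real CARD('n) - 2) * (real CARD('n) - 3) > 0"
    using n by simp
  ultimately show "square_contraction G (curvature_form L) \<le> 0"
    by simp
  assume "square_contraction G (curvature_form L) = 0"
  then have "N = 0"
    using \<open>square_contraction G _ = - _\<close> c n by auto
  then have "h a b = 0" for a b
    unfolding N_def by (simp add: sum_nonneg_eq_0_iff sum_nonneg)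
  then show "form4 L x y z u = 0"
    by (intro flat_if_frame) (simp add: r)
qed

end

section \<open>Curvature at a point of a manifold\<close>

lemma Ck_on_subset:
  assumes "T \<subseteq> S"
  shows "Ck_on k S f \<Longrightarrow> Ck_on k T f"
proof (induction k arbitrary: f)
  case 0
  then show ?case
    using assms continuous_on_subset by auto
next
  case (Suc k)
  then show ?case
    using assms by (metis Ck_on.simps(2) subsetD)
qed

lemma smooth_on_subset: "smooth_on S f \<Longrightarrow> T \<subseteq> S \<Longrightarrow> smooth_on T f"
  unfolding smooth_on_def using Ck_on_subset by blast

lemma smooth_on_differentiable:
  assumes "smooth_on S f" "x \<in> S"
  shows "f differentiable (at x)" "pderivative i f differentiable (at x)"
proof -
  have "Ck_on 2 S f"
    using assms(1) by (simp add: smooth_on_def)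
  then show "f differentiable (at x)" "pderivative i f differentiable (at x)"
    using assms(2) by (auto simp: numeral_2_eq_2)
qed

lemma invertible_if_positive:
  assumes "\<And>v. v \<noteq> 0 \<Longrightarrow> 0 < ip G v v"
  shows "invertible G"
proof -
  have "x = 0" if "G *v x = 0" for x
    using assms[of x] that by (auto simp: ip_def)
  then show ?thesis
    by (simp add: invertible_left_inverse matrix_left_invertible_ker)
qed

lemma coord_metric_C2_intro:
  assumes "open S" "\<And>i j. smooth_on S (\<lambda>x. G x $ i $ j)"
    and "\<And>x. x \<in> S \<Longrightarrow> transpose (G x) = G x"
    and "\<And>x v. x \<in> S \<Longrightarrow> v \<noteq> 0 \<Longrightarrow> 0 < ip (G x) v v"
  shows "coord_metric_C2 S G"
proof
  show "G x $ j $ i = G x $ i $ j" if "x \<in> S" for x i j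
    using arg_cong[OF assms(3)[OF that], of "\<lambda>M. M $ i $ j"] by (simp add: transpose_def)
  show "Ck_on 2 S (\<lambda>y. G y $ i $ j)" for i j
    using assms(2) by (simp add: smooth_on_def)
  show "invertible (G x)" if "x \<in> S" for x
    using assms(4)[OF that] by (rule invertible_if_positive)
  show "open S" by (rule assms(1))
  show "(\<lambda>y. G y $ i $ j) differentiable (at x)" "pderivative k (\<lambda>y. G y $ i $ j) differentiable (at x)"
    if "x \<in> S" for x i j k
    by (rule smooth_on_differentiable[OF assms(2) that])+
qed

lemma coord_curvature_form:
  "coord_curvature G p = curvature_form (\<lambda>i j k l. lowered_curvature G i j k l p)"
  by (simp add: coord_curvature_def curvature_form_def form4_def lowered_curvature_def)

text \<open>A chart is open onto its image, and that image is open in coordinate space.\<close>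

lemma chart_image_open:
  assumes "chart_on X c" "openin X U"
  shows "open (cmap c ` (cdom c \<inter> U))"
proof -
  have "openin (top_of_set (cmap c ` cdom c)) (cmap c ` (cdom c \<inter> U))"
    using assms homeomorphic_imp_open_map openin_subtopology_Int2
    unfolding chart_on_def open_map_def by metis
  then show ?thesis
    using assms(1) unfolding chart_on_def by (auto intro: openin_open_trans)
qed

section \<open>Sign and vanishing of \<open>h4\<close> at a fixed point\<close>

locale riemannian_point =
  fixes X :: "'m topology" and A :: "('m, 'n::finite) chart set" and g :: "('m, 'n) metric" and m :: 'm
  assumes manifold: "riemannian_manifold X A g" and m: "m \<in> topspace X"
begin

definition c where "c = chart_at A m"
definition p where "p = cmap c m"
definition L where "L i j k l = lowered_curvature (g c) i j k l p"

lemma chart: "c \<in> A" "m \<in> cdom c"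
proof -
  have "\<exists>c. c \<in> A \<and> m \<in> cdom c"
    using manifold m unfolding riemannian_manifold_def smooth_manifold_def by blast
  then show "c \<in> A" "m \<in> cdom c"
    unfolding c_def chart_at_def by (metis (mono_tags, lifting) someI_ex)+
qed

lemma chart_on_c: "chart_on X c"
  using manifold chart unfolding riemannian_manifold_def smooth_manifold_def by blast

lemma metric_c:
  assumes "x \<in> cmap c ` cdom c"
  shows "transpose (g c x) = g c x" "v \<noteq> 0 \<Longrightarrow> 0 < ip (g c x) v v"
  using manifold chart(1) assms unfolding riemannian_manifold_def by blast+

text \<open>The set \<open>U\<close> is the whole space for the curvature symmetries, and the
  neighbourhood carrying the flat conformal metric later.\<close>

lemma coord_metric_restrict:
  assumes "openin X U"
  shows "coord_metric_C2 (cmap c ` (cdom c \<inter> U)) (g c)"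
proof (rule coord_metric_C2_intro)
  show "open (cmap c ` (cdom c \<inter> U))"
    using chart_on_c assms by (rule chart_image_open)
  show "smooth_on (cmap c ` (cdom c \<inter> U)) (\<lambda>x. g c x $ i $ j)" for i j
    using manifold chart(1) unfolding riemannian_manifold_def by (blast intro: smooth_on_subset)
qed (use metric_c in auto)

lemma metric_at: "metric_at A g m = g c p"
  by (simp add: metric_at_def c_def p_def)

lemma curvature_at: "curvature_at A g m = curvature_form L"
  by (simp add: curvature_at_def coord_curvature_form c_def p_def L_def[abs_def])

lemma h4: "h4 A g m = square_contraction (g c p) (curvature_form L)"
  by (simp add: h4_def square_contraction_def metric_at curvature_at)

sublocale algebraic_curvature "g c p" L
proof -
  interpret coord_metric_C2 "cmap c ` (cdom c \<inter> topspace X)" "g c"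
    by (rule coord_metric_restrict) simp
  have p: "p \<in> cmap c ` (cdom c \<inter> topspace X)" "p \<in> cmap c ` cdom c"
    using chart(2) m by (auto simp: p_def)
  show "algebraic_curvature (g c p) L"
  proof
    show "L j i k l = - L i j k l" for i j k l
      unfolding L_def by (rule lowered_curvature_skew1)
    show "L i j l k = - L i j k l" for i j k l
      unfolding L_def by (rule lowered_curvature_skew2[OF p(1)])
    show "L k l i j = L i j k l" for i j k l
      unfolding L_def by (rule lowered_curvature_pair[OF p(1)])
  qed (use metric_c[OF p(2)] in auto)
qed

lemma flat_iff: "flat_on {m} A g \<longleftrightarrow> (\<forall>x y z u. form4 L x y z u = 0)"
  by (simp add: flat_on_def curvature_at curvature_form_def)

text \<open>The curvature of the conformal metric vanishes at \<open>p\<close>, so the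
  transformation law leaves the original curvature equal to the product of the metric with
  \<open>schouten_change\<close>.\<close>

lemma conformally_flat_curvature:
  assumes "conformally_flat X A g"
  obtains P where "transpose P = P" and "\<And>i j k l. L i j k l = g c p $ i $ k * P $ j $ l + g c p $ j $ l * P $ i $ k
      - g c p $ i $ l * P $ j $ k - g c p $ j $ k * P $ i $ l"
proof -
  obtain U f where U: "openin X U" "m \<in> U"
    and f: "smooth_on (cmap c ` (cdom c \<inter> U)) (f \<circ> cinv c)"
    and flat: "flat_on U A (conformal_metric f g)"
    using assms m chart(1) unfolding conformally_flat_def by metis
  define S where "S = cmap c ` (cdom c \<inter> U)"
  have p: "p \<in> S"
    using chart(2) U(2) by (auto simp: S_def p_def)
  interpret coord: coord_metric_C2 S "g c"
    unfolding S_def using U(1) by (rule coord_metric_restrict)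
  interpret conformal_change S "g c" "f \<circ> cinv c"
    by unfold_locales (use f in \<open>auto simp: S_def[symmetric] intro: smooth_on_differentiable\<close>)
  have "conformal_metric f g c = scaled"
    by (simp add: conformal_metric_def scaled_def fun_eq_iff)
  \<comment> \<open>The preferred chart depends on \<open>A\<close> and \<open>m\<close> alone, so
    both metrics are expressed in the chart \<open>c\<close>.\<close>
  then have "curvature_at A (conformal_metric f g) m =
      curvature_form (\<lambda>i j k l. lowered_curvature scaled i j k l p)"
    by (simp add: curvature_at_def coord_curvature_form c_def p_def)
  then have "form4 (\<lambda>i j k l. lowered_curvature scaled i j k l p) x y z u = 0" for x y z u
    using flat U(2) by (auto simp: flat_on_def curvature_form_def)
  then have zero: "lowered_curvature scaled i j k l p = 0" for i j k l
    using form4_axis by metis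
  have hess_sym: "pderivative j (pderivative i (f \<circ> cinv c)) p = pderivative i (pderivative j (f \<circ> cinv c)) p" for i j
    using coord.open_S p f by (intro pderivative_commute[of S]) (auto simp: S_def smooth_on_def)
  define P where "P = (\<chi> i j. schouten_change i j p)"
  show thesis
  proof
    show "transpose P = P"
      using coord.sym[OF p] coord.christoffel_commute[OF p] hess_sym
      by (simp add: vec_eq_iff transpose_def P_def schouten_change_def hess_def mult.commute)
    show "L i j k l = g c p $ i $ k * P $ j $ l + g c p $ j $ l * P $ i $ k
      - g c p $ i $ l * P $ j $ k - g c p $ j $ k * P $ i $ l" for i j k l
      using lowered_curvature_scaled[OF p hess_sym, of i j k l] zero by (simp add: L_def P_def)
  qed
qed

lemma h4_flat: "flat_on {m} A g \<Longrightarrow> h4 A g m = 0"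
  unfolding flat_iff h4 by (rule square_contraction_flat) blast

lemma h4_einstein:
  assumes "einstein X A g" "CARD('n) \<ge> 4"
  shows "h4 A g m \<ge> 0" "h4 A g m = 0 \<Longrightarrow> flat_on {m} A g"
proof -
  obtain \<kappa> where "\<And>x y. dval (contract (g c p) (curvature_form L)) [x] [y] = \<kappa> * ip (g c p) x y"
    using assms(1) m unfolding einstein_def ricci_at_def by (metis metric_at curvature_at)
  from square_contraction_einstein[OF this assms(2)]
  show "h4 A g m \<ge> 0" "h4 A g m = 0 \<Longrightarrow> flat_on {m} A g"
    unfolding h4 flat_iff by blast+
qed

lemma h4_conformally_flat:
  assumes "conformally_flat X A g" "scalar_curvature A g m = 0" "CARD('n) \<ge> 4"
  shows "h4 A g m \<le> 0" "h4 A g m = 0 \<Longrightarrow> flat_on {m} A g"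
proof -
  obtain P where P: "transpose P = P" "\<And>i j k l. L i j k l = g c p $ i $ k * P $ j $ l + g c p $ j $ l * P $ i $ k
      - g c p $ i $ l * P $ j $ k - g c p $ j $ k * P $ i $ l"
    using conformally_flat_curvature[OF assms(1)] by blast
  have "dval ((contract (g c p) ^^ 2) (curvature_form L)) [] [] = 0"
    using assms(2) by (simp add: scalar_curvature_def metric_at curvature_at)
  from square_contraction_kulkarni_nomizu[OF P this assms(3)]
  show "h4 A g m \<le> 0" "h4 A g m = 0 \<Longrightarrow> flat_on {m} A g"
    unfolding h4 flat_iff by blast+
qed

end

theorem theorem6p6:
  fixes X :: "'m topology"
    and A :: "('m, 'n::finite) chart set"
    and g :: "('m, 'n) metric"
  assumes "riemannian_manifold X A g"
    and "CARD('n) \<ge> 4"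
  shows "(einstein X A g \<longrightarrow>
            (\<forall>m\<in>topspace X. h4 A g m \<ge> 0) \<and>
            ((\<forall>m\<in>topspace X. h4 A g m = 0) \<longleftrightarrow> flat_on (topspace X) A g)) \<and>
         (conformally_flat X A g \<and> (\<forall>m\<in>topspace X. scalar_curvature A g m = 0) \<longrightarrow>
            (\<forall>m\<in>topspace X. h4 A g m \<le> 0) \<and>
            ((\<forall>m\<in>topspace X. h4 A g m = 0) \<longleftrightarrow> flat_on (topspace X) A g))"
proof -
  have point: "riemannian_point X A g m" if "m \<in> topspace X" for m
    using assms(1) that by (rule riemannian_point.intro)
  \<comment> \<open>Flatness is vanishing of curvature point by point, so both equivalences reduce
    to equivalences at single points.\<close>
  have flat: "flat_on (topspace X) A g \<longleftrightarrow> (\<forall>m\<in>topspace X. flat_on {m} A g)"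
    by (simp add: flat_on_def)
  show ?thesis
    unfolding flat
    using riemannian_point.h4_flat[OF point] riemannian_point.h4_einstein[OF point _ assms(2)]
      riemannian_point.h4_conformally_flat[OF point _ _ assms(2)]
    by blast
qed

end
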